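(* Let $a,b,c$ be relatively shifting prime entire functions of order less than $1$, none of them identically zero, such that $a+b=c$ and such that $a,b,c$ are not all constants. Put $\delta=\max\{\rho(a),\rho(b),\rho(c)\}$, where $\rho$ denotes the order of growth. Then there exists $R>0$ such that for any $\varepsilon>0$ $$\widetilde{T}_{a,b,c}(r)\le \overline{N}_\Delta\Big(r,\frac{1}{abc}\Big)-(1-\delta-\varepsilon)\log r=\overline{N}_\Delta\Big(r,\frac1a\Big)+\overline{N}_\Delta\Big(r,\frac1b\Big)+\overline{N}_\Delta\Big(r,\frac1c\Big)-(1-\delta-\varepsilon)\log r$$ holds for all $r>R$ outside an exceptional set of $r$ of finite logarithmic measure.
   Context: Notation. $\Delta f(z)=f(z+1)-f(z)$, $\Delta^0f=f$, $\Delta^n f=\Delta(\Delta^{n-1}f)$; $z^{\underline{0}}=1$, $z^{\underline{n}}=z(z-1)\cdots(z-n+1)$ for $n\ge1$. A set $E\subset[1,\infty)$ has finite logarithmic measure if $\int_E dr/r<\infty$. Length of zeros. For an entire function $f$, a point $z_0$ is a zero of $f$ with length $n\ge 1$ if $\Delta^k f(z_0)=0$ for all $0\le k<n$ and $\Delta^n f(z_0)\ne0$. Relatively shifting prime. Let $f,g$ be entire, let $z_1$ be a zero of $f$ with length $m$ and $z_2$ a zero of $g$ with length $n$. For $1\le m_1\le m$ and $1\le n_1\le n$ there are entire $F,G$ with $f(z)=(z-z_1)^{\underline{m_1}}F(z)$ and $g(z)=(z-z_2)^{\underline{n_1}}G(z)$. If for some such $m_1,n_1$ one has $f(z)g(z)=(z-z_0)^{\underline{m_1+n_1}}F(z)G(z)$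 with $z_0\in\{z_1,z_2\}$, then $z-z_0$ is called a common shifting divisor of $f$ and $g$. If $f$ and $g$ have no common shifting divisor (for any choice of $z_1,z_2$), they are called relatively shifting prime. (Common zeros are thus not excluded in general.) Three functions are relatively shifting prime if they are so pairwise. Counting functions. For a meromorphic $f\not\equiv0$ let $\mathrm{ord}_w(f)$ be the multiplicity of $w$ as a zero of $f$ ($0$ if $w$ is not a zero). Set $$\overline{n}_\Delta\Big(r,\frac1f\Big)=\sum_{|w|\le r}\Big(\mathrm{ord}_w(f)-\min\{\mathrm{ord}_w(f),\mathrm{Ord}_{w-1}(f)\}\Big),$$ where $\mathrm{Ord}_{w-1}(f)=\mathrm{ord}_{w-1}(f)$ if $|w-1|\le r$ and $\mathrm{Ord}_{w-1}(f)=0$ otherwise, and $$\overline{N}_\Delta\Big(r,\frac1f\Big)=\int_0^r\frac{\overline{n}_\Delta(t,1/f)-\overline{n}_\Delta(0,1/f)}{t}\,dt+\overline{n}_\Delta\Big(0,\frac1f\Big)\log r.$$ Characteristic. For entire functions $a_1,\dots,a_n$ (common zeros allowed), with $u(z)=\max_{1\le j\le n}|a_j(z)|$, $$\widetilde{T}_{a_1,\dots,a_n}(r)=\frac1{2\pi}\int_0^{2\pi}\log u(re^{i\theta})\,d\theta-\log u(0)$$ if $u(0)\ne0$; if $u(0)=0$, the term $\log u(0)$ is replaced by $\max_{j}\log|c_{\lambda_j}|$, where $c_{\lambda_j}z^{\lambda_j}$, $c_{\lambda_j}\neq 0$, is the leading term of the expansion of $a_j$ at $0$. *)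

theory Defs
  imports "HOL-Complex_Analysis.Complex_Analysis"
begin

definition entire :: "(complex \<Rightarrow> complex) \<Rightarrow> bool" where
  "entire f \<longleftrightarrow> f holomorphic_on UNIV"

definition fdiff :: "(complex \<Rightarrow> complex) \<Rightarrow> complex \<Rightarrow> complex" where
  "fdiff f z = f (z + 1) - f z"

definition ffall :: "complex \<Rightarrow> nat \<Rightarrow> complex" where
  "ffall z n = (\<Prod>k<n. z - of_nat k)"

definition zero_of_length :: "(complex \<Rightarrow> complex) \<Rightarrow> complex \<Rightarrow> nat \<Rightarrow> bool" where
  "zero_of_length f z0 n \<longleftrightarrow>
     1 \<le> n \<and> (\<forall>k<n. (fdiff ^^ k) f z0 = 0) \<and> (fdiff ^^ n) f z0 \<noteq> 0"

text \<open>The divisor \<open>z - z0\<close> is represented by the point \<open>z0\<close>.\<close>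

definition common_shifting_divisor ::
    "(complex \<Rightarrow> complex) \<Rightarrow> (complex \<Rightarrow> complex) \<Rightarrow> complex \<Rightarrow> bool" where
  "common_shifting_divisor f g z0 \<longleftrightarrow>
     (\<exists>z1 z2 m n m1 n1 F G.
        zero_of_length f z1 m \<and> zero_of_length g z2 n \<and>
        1 \<le> m1 \<and> m1 \<le> m \<and> 1 \<le> n1 \<and> n1 \<le> n \<and>
        entire F \<and> entire G \<and>
        (\<forall>z. f z = ffall (z - z1) m1 * F z) \<and>
        (\<forall>z. g z = ffall (z - z2) n1 * G z) \<and>
        z0 \<in> {z1, z2} \<and>
        (\<forall>z. f z * g z = ffall (z - z0) (m1 + n1) * F z * G z))"

definition relatively_shifting_prime ::
    "(complex \<Rightarrow> complex) \<Rightarrow> (complex \<Rightarrow> complex) \<Rightarrow> bool" where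
  "relatively_shifting_prime f g \<longleftrightarrow> \<not> (\<exists>z0. common_shifting_divisor f g z0)"

definition relatively_shifting_prime3 ::
    "(complex \<Rightarrow> complex) \<Rightarrow> (complex \<Rightarrow> complex) \<Rightarrow> (complex \<Rightarrow> complex) \<Rightarrow> bool" where
  "relatively_shifting_prime3 f g h \<longleftrightarrow>
     relatively_shifting_prime f g \<and> relatively_shifting_prime f h \<and> relatively_shifting_prime g h"

definition log_plus :: "real \<Rightarrow> real" where
  "log_plus x = ln (max 1 x)"

definition max_modulus :: "(complex \<Rightarrow> complex) \<Rightarrow> real \<Rightarrow> real" where
  "max_modulus f r = (SUP z\<in>sphere 0 r. norm (f z))"

text \<open>The positive parts of the logarithms matter only for constant functions, which get
  order \<open>0\<close>; for other entire functions \<open>max_modulus f r\<close> tends to infinity.\<close>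

definition growth_order :: "(complex \<Rightarrow> complex) \<Rightarrow> ereal" where
  "growth_order f =
     Limsup at_top (\<lambda>r. ereal (log_plus (log_plus (max_modulus f r)) / ln r))"

text \<open>The order \<open>zorder\<close> is negative at poles, where truncation by \<open>nat\<close> gives multiplicity \<open>0\<close>.\<close>

definition zero_mult :: "(complex \<Rightarrow> complex) \<Rightarrow> complex \<Rightarrow> nat" where
  "zero_mult f w = nat (zorder f w)"

text \<open>Both functions below count the zeros of \<open>f\<close>; the usual notation has \<open>1/f\<close> as argument.
  The sum is restricted to the points of positive multiplicity so that its index set is finite;
  all other points of the disc contribute \<open>0\<close>.\<close>

definition nbar_delta :: "(complex \<Rightarrow> complex) \<Rightarrow> real \<Rightarrow> real" where
  "nbar_delta f r =
     (\<Sum>w | norm w \<le> r \<and> zero_mult f w > 0.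
        real (zero_mult f w)
        - real (min (zero_mult f w) (if norm (w - 1) \<le> r then zero_mult f (w - 1) else 0)))"

definition Nbar_delta :: "(complex \<Rightarrow> complex) \<Rightarrow> real \<Rightarrow> real" where
  "Nbar_delta f r =
     integral {0..r} (\<lambda>t. (nbar_delta f t - nbar_delta f 0) / t) + nbar_delta f 0 * ln r"

definition lead_coeff_at_0 :: "(complex \<Rightarrow> complex) \<Rightarrow> complex" where
  "lead_coeff_at_0 f = fps_nth (fps_expansion f 0) (subdegree (fps_expansion f 0))"

definition max_norm :: "(complex \<Rightarrow> complex) list \<Rightarrow> complex \<Rightarrow> real" where
  "max_norm fs z = Max ((\<lambda>f. norm (f z)) ` set fs)"

text \<open>If all functions vanish at \<open>0\<close>, the normalizing constant is the maximum over all of them,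
  not only over those with the least order of vanishing; only the zero function, which has
  no leading term, is left out.\<close>

definition T_tilde :: "(complex \<Rightarrow> complex) list \<Rightarrow> real \<Rightarrow> real" where
  "T_tilde fs r =
     1 / (2 * pi) * integral {0..2 * pi} (\<lambda>\<theta>. ln (max_norm fs (of_real r * cis \<theta>)))
     - (if max_norm fs 0 \<noteq> 0 then ln (max_norm fs 0)
        else Max ((\<lambda>f. ln (norm (lead_coeff_at_0 f))) ` {f \<in> set fs. f \<noteq> (\<lambda>_. 0)}))"

definition finite_log_measure :: "real set \<Rightarrow> bool" where
  "finite_log_measure E \<longleftrightarrow>
     E \<subseteq> {1..} \<and> E \<in> sets lebesgue \<and> (\<integral>\<^sup>+r\<in>E. ennreal (1 / r) \<partial>lebesgue) < \<infinity>"

end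

theory Submission
  imports Defs "HOL-Real_Asymp.Real_Asymp"
begin

text \<open>The proof compares the three functions with their Casoratian
  \<open>W z = a z * b (z + 1) - a (z + 1) * b z\<close>, which up to sign does not change when one of
  \<open>a\<close>, \<open>b\<close> is replaced by \<open>c\<close>. For an entire function \<open>f\<close> of order less than 1 the quotient
  \<open>f (z + 1) / f z\<close> is a product over the zeros \<open>w\<close> of the factors \<open>1 + 1 / (z - w)\<close>, so that
  \<open>f (z + 1) / f z - 1\<close> is of size \<open>r powr (\<delta> - 1 + \<epsilon>)\<close> on \<open>norm z = r\<close> outside an exceptional set
  of radii. Hence \<open>norm (W z) * max_norm [a, b, c] z\<close> is at most
  \<open>4 * r powr (\<delta> - 1 + \<epsilon>) * norm (a z * b z * c z)\<close> there, and Jensen's formula for \<open>W\<close> and for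
  \<open>a * b * c\<close> turns this into the bound for \<open>T_tilde\<close>. Being relatively shifting prime means that no
  zero of one function is adjacent (at distance 1 along the shift) to a zero of another, so that the
  zeros discounted in \<open>Nbar_delta\<close> come from a single function and are zeros of \<open>W\<close>.\<close>

section \<open>Zeros of entire functions\<close>

text \<open>The Casoratian takes the place that the Wronskian has in the Mason--Stothers theorem: a
  zero common to \<open>f\<close> and its shift is inherited by \<open>W\<close>, because each term
  of \<open>W\<close> contains \<open>f z\<close> or \<open>f (z + 1)\<close>. Two obstacles shape
  the argument. Common zeros at the same point are allowed, so \<open>W\<close> may vanish
  identically; the functions are then proportional, and it is their not being constant that provides
  a zero to gain from. Moreover Jensen's formula leaves an additive constant, paid for with a part
  of \<open>\<epsilon>\<close>; as \<open>R\<close> may not depend on \<open>\<epsilon>\<close>, the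
  radii that are too small for this go into the exceptional set. Order below 1 enters twice: the
  exponent of the shift estimate is negative, and the zeros determine a function up to a constant
  factor.\<close>

lemma entire_holomorphic_on: "entire f \<Longrightarrow> f holomorphic_on A"
  unfolding entire_def by (rule holomorphic_on_subset) auto

lemma entire_continuous_on: "entire f \<Longrightarrow> continuous_on A f"
  using entire_holomorphic_on holomorphic_on_imp_continuous_on by blast

lemma entire_nonzero_ex: "f \<noteq> (\<lambda>_. 0) \<Longrightarrow> \<exists>z\<in>UNIV. f z \<noteq> (0::complex)"
  by auto

lemma entire_finite_zeros:
  assumes "entire f" "f \<noteq> (\<lambda>_. 0)"
  shows "finite {z. norm z \<le> R \<and> f z = 0}"
proof -
  obtain z where z: "f z \<noteq> 0" using assms(2) by auto
  define R' where "R' = max R (norm z)"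
  have "finite {z \<in> cball 0 R'. f z = 0}"
  proof (cases "\<exists>w\<in>cball 0 R'. f w = 0")
    case True
    have nc: "\<not> f constant_on UNIV"
      using z True by (metis constant_on_def UNIV_I)
    show ?thesis
      by (rule holomorphic_compact_finite_zeros[of f UNIV])
        (use assms nc entire_holomorphic_on in auto)
  next
    case False
    then have "{z \<in> cball 0 R'. f z = 0} = {}" by blast
    then show ?thesis by (simp only: finite.emptyI)
  qed
  then show ?thesis
    by (rule finite_subset[rotated]) (auto simp: R'_def)
qed

lemma entire_countable_zeros:
  assumes "entire f" "f \<noteq> (\<lambda>_. 0)"
  shows "countable {z. f z = 0}"
proof -
  have "{z. f z = 0} = (\<Union>n::nat. {z. norm z \<le> real n \<and> f z = 0})"
    using real_arch_simple by auto
  moreover have "countable (\<Union>n::nat. {z. norm z \<le> real n \<and> f z = 0})"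
    using entire_finite_zeros[OF assms] by (intro countable_UN) (auto intro: countable_finite)
  ultimately show ?thesis by simp
qed

section \<open>Multiplicities and splitting off zeros\<close>

lemma zero_mult_eqI:
  assumes "entire g" "g w \<noteq> 0" "\<And>z. f z = (z - w) ^ n * g z"
  shows "zero_mult f w = n"
proof -
  have "zorder f w = int n"
    by (rule zorder_eqI[of UNIV _ g])
      (use assms in \<open>auto simp: entire_def power_int_def mult.commute\<close>)
  then show ?thesis by (simp add: zero_mult_def)
qed

text \<open>The order of vanishing yields a cofactor only on a disc about \<open>w\<close>. Away
  from \<open>w\<close> the cofactor is the plain quotient, so the two holomorphic pieces glue to an
  entire function.\<close>

lemma zero_mult_factor:
  assumes "entire f" "f \<noteq> (\<lambda>_. 0)"
  obtains g where "entire g" "g w \<noteq> 0" "\<And>z. f z = (z - w) ^ zero_mult f w * g z"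
proof -
  define n where "n = zero_mult f w"
  have "\<exists>r>0. zor_poly f w holomorphic_on cball w r \<and>
    (\<forall>z\<in>cball w r. f z = zor_poly f w z * (z - w) ^ n \<and> zor_poly f w z \<noteq> 0)"
    using zorder_exist_zero[of f UNIV w] assms entire_nonzero_ex[of f]
    by (simp add: entire_def n_def zero_mult_def connected_UNIV split: if_splits)
  then obtain r where r: "r > 0" "zor_poly f w holomorphic_on cball w r"
    "\<And>z. z \<in> cball w r \<Longrightarrow> f z = zor_poly f w z * (z - w) ^ n"
    "\<And>z. z \<in> cball w r \<Longrightarrow> zor_poly f w z \<noteq> 0"
    by blast
  define g where "g z = (if z = w then zor_poly f w w else f z / (z - w) ^ n)" for z
  have eq: "g z = zor_poly f w z" if "z \<in> ball w r" for z
    using that r(3)[of z] by (auto simp: g_def)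
  have "g holomorphic_on ball w r"
    using holomorphic_on_subset[OF r(2) ball_subset_cball] eq[symmetric]
    by (rule holomorphic_transform)
  moreover have "g holomorphic_on - {w}"
  proof -
    have "(\<lambda>z. f z / (z - w) ^ n) holomorphic_on - {w}"
      using assms by (intro holomorphic_intros entire_holomorphic_on) auto
    then show ?thesis
      by (rule holomorphic_transform) (auto simp: g_def)
  qed
  ultimately have "g holomorphic_on ball w r \<union> - {w}"
    by (intro holomorphic_on_Un) auto
  moreover have "ball w r \<union> - {w} = UNIV" using r(1) by auto
  ultimately have "entire g" by (simp add: entire_def)
  moreover have "g w \<noteq> 0" using r(1,4) by (simp add: g_def)
  moreover have "f z = (z - w) ^ n * g z" for z
    using r(3)[of w] r(1) by (cases "z = w") (auto simp: g_def)
  ultimately show ?thesis using that n_def by blast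
qed

lemma zero_mult_pos_iff:
  assumes "entire f" "f \<noteq> (\<lambda>_. 0)"
  shows "zero_mult f w > 0 \<longleftrightarrow> f w = 0"
proof -
  obtain g where "entire g" "g w \<noteq> 0" and g: "\<And>z. f z = (z - w) ^ zero_mult f w * g z"
    using zero_mult_factor[OF assms] by blast
  then show ?thesis using g[of w] by auto
qed

lemma zero_mult_eq_0:
  assumes "entire f" "f w \<noteq> 0"
  shows "zero_mult f w = 0"
  using zero_mult_pos_iff[of f w] assms by fastforce

lemma zero_mult_geI:
  assumes "entire f" "f \<noteq> (\<lambda>_. 0)" "entire g" "\<And>z. f z = (z - w) ^ n * g z"
  shows "n \<le> zero_mult f w"
proof -
  have "g \<noteq> (\<lambda>_. 0)" using assms(2,4) by auto
  then obtain h where h: "entire h" "h w \<noteq> 0" "\<And>z. g z = (z - w) ^ zero_mult g w * h z"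
    using zero_mult_factor[OF assms(3)] by blast
  have "zero_mult f w = n + zero_mult g w"
    by (rule zero_mult_eqI[OF h(1,2)]) (simp add: assms(4) h(3) power_add)
  then show ?thesis by simp
qed

lemma entire_mult: "entire f \<Longrightarrow> entire g \<Longrightarrow> entire (\<lambda>z. f z * g z)"
  unfolding entire_def by (intro holomorphic_intros)

lemma entire_prod_linear_powers: "entire (\<lambda>z. \<Prod>w\<in>S. (z - w) ^ m w)"
  unfolding entire_def by (intro holomorphic_intros)

lemma entire_shift: "entire f \<Longrightarrow> entire (\<lambda>z. f (z + c))"
  unfolding entire_def
  by (rule holomorphic_on_compose_gen[of "\<lambda>z. z + c" _ f UNIV, unfolded o_def])
    (auto intro!: holomorphic_intros)

lemma entire_diff: "entire f \<Longrightarrow> entire g \<Longrightarrow> entire (\<lambda>z. f z - g z)"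
  unfolding entire_def by (intro holomorphic_intros)

lemma entire_mult_nonzero:
  assumes "entire f" "entire g" "f \<noteq> (\<lambda>_. 0)" "g \<noteq> (\<lambda>_. 0)"
  shows "(\<lambda>z. f z * g z) \<noteq> (\<lambda>_. 0)"
proof
  assume "(\<lambda>z. f z * g z) = (\<lambda>_. 0)"
  then have "UNIV = {z. f z = 0} \<union> {z. g z = 0}"
    by (auto simp: fun_eq_iff)
  then have "countable (UNIV :: complex set)"
    using entire_countable_zeros assms by (metis countable_Un)
  then show False using uncountable_UNIV_complex by blast
qed

lemma zero_mult_mult:
  assumes "entire f" "entire g" "f \<noteq> (\<lambda>_. 0)" "g \<noteq> (\<lambda>_. 0)"
  shows "zero_mult (\<lambda>z. f z * g z) w = zero_mult f w + zero_mult g w"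
proof -
  obtain F where F: "entire F" "F w \<noteq> 0" "\<And>z. f z = (z - w) ^ zero_mult f w * F z"
    using zero_mult_factor[OF assms(1,3)] by blast
  obtain G where G: "entire G" "G w \<noteq> 0" "\<And>z. g z = (z - w) ^ zero_mult g w * G z"
    using zero_mult_factor[OF assms(2,4)] by blast
  show ?thesis
    by (rule zero_mult_eqI[OF entire_mult[OF F(1) G(1)]])
      (use F G in \<open>simp_all add: power_add\<close>)
qed

text \<open>Points of \<open>S\<close> where \<open>f\<close> does not vanish enter with exponent 0,
  so \<open>S\<close> may be any finite set. The factors already split off do not vanish at a new
  point, hence \<open>f\<close> and the remaining cofactor have the same multiplicity there.\<close>

lemma entire_factor_zeros:
  assumes "entire f" "f \<noteq> (\<lambda>_. 0)" "finite S"
  obtains h where "entire h" "\<And>z. f z = (\<Prod>w\<in>S. (z - w) ^ zero_mult f w) * h z"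
    "\<And>z. h z = 0 \<longleftrightarrow> z \<notin> S \<and> f z = 0"
proof -
  have "\<exists>h. entire h \<and> (\<forall>z. f z = (\<Prod>w\<in>S. (z - w) ^ zero_mult f w) * h z) \<and>
    (\<forall>z\<in>S. h z \<noteq> 0)"
    using assms(3)
  proof (induction S)
    case empty
    then show ?case using assms(1) by auto
  next
    case (insert x S)
    then obtain h where h: "entire h" "\<And>z. f z = (\<Prod>w\<in>S. (z - w) ^ zero_mult f w) * h z"
      "\<And>z. z \<in> S \<Longrightarrow> h z \<noteq> 0" by blast
    have "h \<noteq> (\<lambda>_. 0)" using h(2) assms(2) by auto
    then obtain g where g: "entire g" "g x \<noteq> 0" "\<And>z. h z = (z - x) ^ zero_mult h x * g z"
      using zero_mult_factor[OF h(1)] by blast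
    have "zero_mult f x = zero_mult h x"
    proof (rule zero_mult_eqI)
      show "entire (\<lambda>z. (\<Prod>w\<in>S. (z - w) ^ zero_mult f w) * g z)"
        by (intro entire_mult entire_prod_linear_powers g)
      show "(\<Prod>w\<in>S. (x - w) ^ zero_mult f w) * g x \<noteq> 0"
        using g(2) insert(1,2) by auto
      show "f z = (z - x) ^ zero_mult h x * ((\<Prod>w\<in>S. (z - w) ^ zero_mult f w) * g z)" for z
        using h(2)[of z] g(3)[of z] by simp
    qed
    then have "\<forall>z. f z = (\<Prod>w\<in>insert x S. (z - w) ^ zero_mult f w) * g z"
      using h(2) g(3) insert(1,2) by (auto simp: mult.assoc mult.left_commute)
    moreover have "\<forall>z\<in>insert x S. g z \<noteq> 0"
      using g(2,3) h(3) by auto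
    ultimately show ?case using g(1) by blast
  qed
  then obtain h where h: "entire h" "\<And>z. f z = (\<Prod>w\<in>S. (z - w) ^ zero_mult f w) * h z"
    "\<And>z. z \<in> S \<Longrightarrow> h z \<noteq> 0" by blast
  have "h z = 0 \<longleftrightarrow> z \<notin> S \<and> f z = 0" for z
    using h(2)[of z] h(3)[of z] assms(3) by auto
  with h that show ?thesis by blast
qed

section \<open>Entire functions of order less than one\<close>

definition zero_count :: "(complex \<Rightarrow> complex) \<Rightarrow> real \<Rightarrow> nat" where
  "zero_count f R = (\<Sum>w | norm w \<le> R \<and> f w = 0. zero_mult f w)"

definition growth_le :: "(complex \<Rightarrow> complex) \<Rightarrow> real \<Rightarrow> bool" where
  "growth_le f s \<longleftrightarrow> (\<exists>r0. \<forall>z. norm z \<ge> r0 \<longrightarrow> norm (f z) \<le> exp (norm z powr s))"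

lemma log_plus_nonneg: "log_plus x \<ge> 0"
  by (simp add: log_plus_def)

lemma log_plus_less_iff: "log_plus x < y \<Longrightarrow> x < exp y"
  using exp_less_mono[of "log_plus x" y] by (simp add: log_plus_def)

lemma growth_order_nonneg: "growth_order f \<ge> 0"
proof -
  have "\<forall>\<^sub>F r in at_top. 0 \<le> ereal (log_plus (log_plus (max_modulus f r)) / ln r)"
    using eventually_ge_at_top[of "1::real"]
    by eventually_elim (auto intro!: divide_nonneg_nonneg log_plus_nonneg)
  then have "Limsup at_top (\<lambda>_::real. 0) \<le> growth_order f"
    unfolding growth_order_def by (rule Limsup_mono)
  then show ?thesis by (simp add: Limsup_const)
qed

lemma norm_le_max_modulus:
  assumes "entire f"
  shows "norm (f z) \<le> max_modulus f (norm z)"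
  unfolding max_modulus_def
proof (rule cSUP_upper)
  have "compact ((\<lambda>z. norm (f z)) ` sphere 0 (norm z))"
    by (intro compact_continuous_image continuous_intros entire_continuous_on assms) auto
  then show "bdd_above ((\<lambda>z. norm (f z)) ` sphere 0 (norm z))"
    by (intro bounded_imp_bdd_above compact_imp_bounded)
qed auto

lemma growth_le_if_growth_order_less:
  assumes "entire f" "growth_order f < ereal s"
  shows "growth_le f s"
proof -
  have "\<forall>\<^sub>F r in at_top. ereal (log_plus (log_plus (max_modulus f r)) / ln r) < ereal s"
    using assms(2) unfolding growth_order_def by (rule Limsup_lessD)
  then obtain r1 where r1: "\<And>r. r \<ge> r1 \<Longrightarrow> log_plus (log_plus (max_modulus f r)) / ln r < s"
    by (auto simp: eventually_at_top_linorder)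
  have "norm (f z) \<le> exp (norm z powr s)" if "norm z \<ge> max r1 2" for z
  proof -
    let ?r = "norm z" and ?M = "max_modulus f (norm z)"
    have r: "?r \<ge> 2" "?r \<ge> r1" using that by auto
    have "log_plus (log_plus ?M) < s * ln ?r"
      using r1[OF r(2)] r(1) ln_gt_zero[of ?r] by (simp add: pos_divide_less_eq)
    then have "log_plus ?M < ?r powr s"
      using r log_plus_less_iff[of "log_plus ?M" "s * ln ?r"] by (auto simp: powr_def)
    then have "?M < exp (?r powr s)"
      using log_plus_less_iff by blast
    then show ?thesis using norm_le_max_modulus[OF assms(1), of z] by linarith
  qed
  then show ?thesis unfolding growth_le_def by blast
qed

text \<open>The circle of radius \<open>5 * R\<close> has distance at least \<open>4 * R\<close>
  from every zero counted, while points of the disc of radius \<open>R\<close> are within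
  \<open>2 * R\<close> of it. The maximum principle for \<open>h\<close> thus gains a factor 2 per
  zero. With \<open>z' = z\<close> this counts zeros; with \<open>z'\<close> free it bounds
  \<open>h z' / h z\<close>.\<close>

lemma zero_free_part_bound:
  assumes "entire f" "f \<noteq> (\<lambda>_. 0)" "R > 0"
    and M: "\<And>\<zeta>. norm \<zeta> = 5 * R \<Longrightarrow> norm (f \<zeta>) \<le> M"
    and h: "entire h" "\<And>z. f z = (\<Prod>w | norm w \<le> R \<and> f w = 0. (z - w) ^ zero_mult f w) * h z"
    and z: "norm z \<le> R" and z': "norm z' \<le> R"
  shows "norm (h z') * 2 ^ zero_count f R * norm (f z) \<le> M * norm (h z)"
proof -
  define S where "S = {w. norm w \<le> R \<and> f w = 0}"
  define n where "n = zero_count f R"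
  have n: "n = (\<Sum>w\<in>S. zero_mult f w)" by (simp add: n_def S_def zero_count_def)
  have f: "norm (f z) = (\<Prod>w\<in>S. norm (z - w) ^ zero_mult f w) * norm (h z)" for z
    by (subst h(2)) (simp add: S_def norm_mult norm_power flip: prod_norm)
  have "norm (h z') \<le> M / (4 * R) ^ n"
  proof (rule maximum_modulus_frontier[of h "cball 0 (5 * R)"])
    show "z' \<in> cball 0 (5 * R)" using z' \<open>R > 0\<close> by auto
    fix \<zeta> assume "\<zeta> \<in> frontier (cball 0 (5 * R) :: complex set)"
    then have \<zeta>: "norm \<zeta> = 5 * R" by auto
    have "(4 * R) ^ n = (\<Prod>w\<in>S. (4 * R) ^ zero_mult f w)"
      unfolding n by (rule power_sum)
    also have "\<dots> \<le> (\<Prod>w\<in>S. norm (\<zeta> - w) ^ zero_mult f w)"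
    proof (intro prod_mono conjI power_mono)
      fix w assume "w \<in> S"
      then have "norm w \<le> R" by (simp add: S_def)
      then show "4 * R \<le> norm (\<zeta> - w)" using \<zeta> norm_triangle_ineq2[of \<zeta> w] by linarith
    qed (use \<open>R > 0\<close> in auto)
    finally have "(4 * R) ^ n * norm (h \<zeta>) \<le> norm (f \<zeta>)"
      unfolding f by (intro mult_right_mono) auto
    then have "(4 * R) ^ n * norm (h \<zeta>) \<le> M" using M[OF \<zeta>] by linarith
    then show "norm (h \<zeta>) \<le> M / (4 * R) ^ n"
      using \<open>R > 0\<close> by (simp add: field_simps)
  qed (use h(1) in \<open>auto intro: entire_holomorphic_on entire_continuous_on\<close>)
  moreover have "norm (f z) \<le> (2 * R) ^ n * norm (h z)"
  proof -
    have "(\<Prod>w\<in>S. norm (z - w) ^ zero_mult f w) \<le> (\<Prod>w\<in>S. (2 * R) ^ zero_mult f w)"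
    proof (intro prod_mono conjI power_mono)
      fix w assume "w \<in> S"
      then have "norm w \<le> R" by (simp add: S_def)
      then show "norm (z - w) \<le> 2 * R" using z norm_triangle_ineq4[of z w] by linarith
    qed auto
    also have "\<dots> = (2 * R) ^ n" unfolding n by (rule power_sum[symmetric])
    finally show ?thesis unfolding f by (intro mult_right_mono) auto
  qed
  ultimately have "norm (h z') * norm (f z) \<le> M / (4 * R) ^ n * ((2 * R) ^ n * norm (h z))"
    by (intro mult_mono) (auto intro: order_trans[OF norm_ge_zero])
  also have "\<dots> = M * norm (h z) / 2 ^ n"
  proof -
    define Q where "Q = (2 * R) ^ n"
    have "(4 * R) ^ n = 2 ^ n * Q"
      unfolding Q_def power_mult_distrib[symmetric] by simp
    moreover have "Q \<noteq> 0" using \<open>R > 0\<close> by (simp add: Q_def)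
    ultimately show ?thesis unfolding Q_def[symmetric] by simp
  qed
  finally show ?thesis by (simp add: n_def pos_le_divide_eq mult_ac)
qed

lemma zero_count_mono:
  assumes "entire f" "f \<noteq> (\<lambda>_. 0)" "R \<le> R'"
  shows "zero_count f R \<le> zero_count f R'"
  unfolding zero_count_def
  by (rule sum_mono2) (use entire_finite_zeros[OF assms(1,2)] assms(3) in auto)

text \<open>At a fixed point with \<open>f z \<noteq> 0\<close> the factor \<open>norm (h z)\<close>
  cancels, and the growth of \<open>f\<close> bounds \<open>2 ^ zero_count f R\<close>. Logarithms
  give \<open>C1\<close> for large \<open>R\<close>; monotonicity covers the remaining radii down to
  1.\<close>

lemma zero_count_bound:
  assumes "entire f" "f \<noteq> (\<lambda>_. 0)" "growth_le f s" "s > 0"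
  obtains C where "C \<ge> 0" "\<And>R. R \<ge> 1 \<Longrightarrow> real (zero_count f R) \<le> C * R powr s"
proof -
  obtain z where z: "f z \<noteq> 0" using assms(2) by auto
  obtain r0 where r0: "\<And>z. norm z \<ge> r0 \<Longrightarrow> norm (f z) \<le> exp (norm z powr s)"
    using assms(3) unfolding growth_le_def by blast
  define R1 where "R1 = Max {1, norm z, r0}"
  define L where "L = \<bar>ln (norm (f z))\<bar>"
  define C1 where "C1 = (5 powr s + L) / ln 2"
  have large: "real (zero_count f R) \<le> C1 * R powr s" if "R \<ge> R1" for R
  proof -
    have R: "R \<ge> 1" "R \<ge> norm z" "R \<ge> r0" "R > 0" using that by (auto simp: R1_def)
    obtain h where h: "entire h"
      "\<And>z. f z = (\<Prod>w | norm w \<le> R \<and> f w = 0. (z - w) ^ zero_mult f w) * h z"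
      "\<And>z. h z = 0 \<longleftrightarrow> z \<notin> {w. norm w \<le> R \<and> f w = 0} \<and> f z = 0"
      using entire_factor_zeros[OF assms(1,2) entire_finite_zeros[OF assms(1,2), of R]] by blast
    have "norm (h z) * 2 ^ zero_count f R * norm (f z) \<le> exp ((5 * R) powr s) * norm (h z)"
    proof (rule zero_free_part_bound[OF assms(1,2) R(4) _ h(1,2) R(2) R(2)])
      fix \<zeta> :: complex assume "norm \<zeta> = 5 * R"
      then show "norm (f \<zeta>) \<le> exp ((5 * R) powr s)" using r0[of \<zeta>] R by simp
    qed
    then have "2 ^ zero_count f R * norm (f z) \<le> exp ((5 * R) powr s)"
      using h(3)[of z] z by (simp add: mult.assoc mult.commute[of "norm (h z)"])
    then have "ln (2 ^ zero_count f R * norm (f z)) \<le> ln (exp ((5 * R) powr s))"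
      using z by (subst ln_le_cancel_iff) auto
    then have "real (zero_count f R) * ln 2 \<le> (5 * R) powr s + L"
      using z by (simp add: ln_mult ln_realpow L_def)
    also have "\<dots> \<le> (5 powr s + L) * R powr s"
    proof -
      have "L * 1 \<le> L * R powr s"
        using R assms(4) by (intro mult_left_mono ge_one_powr_ge_zero) (auto simp: L_def)
      then show ?thesis using R by (simp add: powr_mult algebra_simps)
    qed
    finally show ?thesis by (simp add: C1_def field_simps)
  qed
  define C where "C = max C1 (real (zero_count f R1))"
  have "real (zero_count f R) \<le> C * R powr s" if "R \<ge> 1" for R
  proof (cases "R \<ge> R1")
    case True
    have "C1 * R powr s \<le> C * R powr s" by (intro mult_right_mono) (auto simp: C_def)
    with large[OF True] show ?thesis by linarith
  next
    case False
    then have "real (zero_count f R) \<le> C"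
      using zero_count_mono[OF assms(1,2), of R R1] by (simp add: C_def)
    also have "C * 1 \<le> C * R powr s"
      using that assms(4) by (intro mult_left_mono ge_one_powr_ge_zero) (auto simp: C_def)
    finally show ?thesis by simp
  qed
  moreover have "C \<ge> 0" by (simp add: C_def)
  ultimately show ?thesis using that by blast
qed

text \<open>The map taking \<open>x\<close> to \<open>x / (2 * A - x)\<close> carries the half-plane
  \<open>Re x < A\<close> into the unit disc and fixes 0, so the Schwarz lemma applies. With
  \<open>u\<close> in the disc of half the radius, half of \<open>norm (g u)\<close> can be absorbed
  on the left, which turns 2 into 4.\<close>

lemma borel_caratheodory:
  assumes g: "g holomorphic_on ball z \<rho>" "g z = 0"
    and A: "\<And>x. x \<in> ball z \<rho> \<Longrightarrow> Re (g x) < A"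
    and \<rho>: "\<rho> > 0" and u: "norm (u - z) \<le> \<rho> / 2"
  shows "norm (g u) \<le> 4 * A * norm (u - z) / \<rho>"
proof -
  have "A > 0" using A[of z] g(2) \<rho> by simp
  define \<phi> where "\<phi> \<xi> = g (z + \<rho> * \<xi>) / (2 * A - g (z + \<rho> * \<xi>))" for \<xi> :: complex
  have in_ball: "z + \<rho> * \<xi> \<in> ball z \<rho>" if "norm \<xi> < 1" for \<xi> :: complex
    using that \<rho> by (simp add: dist_norm norm_mult)
  have less: "norm (g x) < norm (2 * A - g x)" if "x \<in> ball z \<rho>" for x
  proof -
    \<comment> \<open>The difference of the squared moduli is
      \<open>4 * A * (A - Re (g x))\<close>.\<close>
    have "A * (A - Re (g x)) > 0" using A[OF that] \<open>A > 0\<close> by simp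
    then have "(Re (g x))\<^sup>2 + (Im (g x))\<^sup>2 < (2 * A - Re (g x))\<^sup>2 + (Im (g x))\<^sup>2"
      by (simp add: power2_eq_square algebra_simps)
    then show ?thesis by (simp add: cmod_def)
  qed
  have "norm (\<phi> ((u - z) / \<rho>)) \<le> norm ((u - z) / \<rho>)"
  proof (rule Schwarz_Lemma(1))
    have "(\<lambda>\<xi>. g (z + \<rho> * \<xi>)) holomorphic_on ball 0 1"
      by (rule holomorphic_on_compose_gen[OF _ g(1), unfolded o_def])
        (auto intro!: holomorphic_intros in_ball simp del: mem_ball)
    then show "\<phi> holomorphic_on ball 0 1"
      unfolding \<phi>_def
    proof (intro holomorphic_intros)
      fix \<xi> :: complex assume "\<xi> \<in> ball 0 1"
      then show "2 * A - g (z + \<rho> * \<xi>) \<noteq> 0"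
        using less[OF in_ball[of \<xi>]] by auto
    qed
    show "\<phi> 0 = 0" by (simp add: \<phi>_def g)
    show "norm (\<phi> \<xi>) < 1" if "norm \<xi> < 1" for \<xi>
      using less[OF in_ball[OF that]] le_less_trans[OF norm_ge_zero less[OF in_ball[OF that]]]
      by (simp add: \<phi>_def norm_divide divide_less_eq)
    show "norm ((u - z) / \<rho>) < 1" using u \<rho> by (simp add: norm_divide field_simps)
  qed
  moreover have "z + \<rho> * ((u - z) / \<rho>) = u" using \<rho> by simp
  moreover define x where "x = norm (u - z) / \<rho>"
  ultimately have le: "norm (g u) / norm (2 * A - g u) \<le> x"
    using \<rho> by (simp add: \<phi>_def norm_divide)
  have x: "x \<ge> 0" "x \<le> 1/2" using u \<rho> by (auto simp: x_def field_simps)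
  have "u \<in> ball z \<rho>" using u \<rho> by (simp add: dist_norm norm_minus_commute)
  then have "norm (2 * A - g u) > 0" using less[of u] norm_ge_zero[of "g u"] by linarith
  then have "norm (g u) \<le> x * norm (2 * A - g u)" using le by (simp add: field_simps)
  also have "\<dots> \<le> x * (2 * A + norm (g u))"
    using norm_triangle_ineq4[of "complex_of_real (2 * A)" "g u"] \<open>A > 0\<close> x
    by (intro mult_left_mono) (auto simp: norm_mult)
  also have "\<dots> \<le> 2 * A * x + norm (g u) / 2"
    using mult_right_mono[OF x(2) norm_ge_zero[of "g u"]] by (simp add: algebra_simps)
  finally show ?thesis by (simp add: x_def)
qed

text \<open>This replaces Hadamard's factorization in genus 0: after the zeros in the disc of radius
  \<open>N\<close> are divided out, Borel--Caratheodory shows that what remains is asymptotically constant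
  on bounded sets, because \<open>N powr s / N \<longlonglongrightarrow> 0\<close>.\<close>

lemma quotient_as_limit_of_zero_products:
  assumes "entire f" "f \<noteq> (\<lambda>_. 0)" "growth_le f s" "0 < s" "s < 1" "f z \<noteq> 0"
  shows "(\<lambda>N::nat. \<Prod>w | norm w \<le> real N \<and> f w = 0. ((u - w) / (z - w)) ^ zero_mult f w)
    \<longlonglongrightarrow> f u / f z"
proof -
  obtain r0 where r0: "\<And>z. norm z \<ge> r0 \<Longrightarrow> norm (f z) \<le> exp (norm z powr s)"
    using assms(3) unfolding growth_le_def by blast
  define P where "P N = (\<Prod>w | norm w \<le> real N \<and> f w = 0. ((u - w) / (z - w)) ^ zero_mult f w)"
    for N :: nat
  define d where "d = norm (u - z)"
  define A where "A N = (5 * real N) powr s + \<bar>ln (norm (f z))\<bar> + 1" for N :: nat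
  \<comment> \<open>\<open>2 * norm z\<close> keeps the disc of radius \<open>R / 2\<close> about
    \<open>z\<close> inside the disc of radius \<open>R\<close>, and \<open>4 * d\<close> puts
    \<open>u\<close> into the half of it where \<open>borel_caratheodory\<close> applies. The 8 is 4
    divided by the 1/2 in that radius.\<close>
  have "\<exists>\<gamma>. norm \<gamma> \<le> 8 * A N * d / N \<and> P N = f u / f z * exp \<gamma>"
    if "real N \<ge> Max {1, r0, 2 * norm z, norm u, 4 * d}" for N
  proof -
    define R where "R = real N"
    have R: "R \<ge> 1" "R \<ge> r0" "R \<ge> 2 * norm z" "R \<ge> norm u" "R \<ge> 4 * d" "R > 0" "R \<ge> norm z"
      using that norm_ge_zero[of z] unfolding R_def by simp_all
    let ?S = "{w. norm w \<le> R \<and> f w = 0}"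
    obtain h where h: "entire h"
      "\<And>z. f z = (\<Prod>w\<in>?S. (z - w) ^ zero_mult f w) * h z"
      "\<And>z. h z = 0 \<longleftrightarrow> z \<notin> {w. norm w \<le> R \<and> f w = 0} \<and> f z = 0"
      using entire_factor_zeros[OF assms(1,2) entire_finite_zeros[OF assms(1,2), of R]] by blast
    have ball: "norm x \<le> R" if "x \<in> ball z (R / 2)" for x
    proof -
      have "norm (x - z) < R / 2" using that by (simp add: dist_norm norm_minus_commute)
      then show ?thesis using R(3) norm_triangle_sub[of x z] by linarith
    qed
    have h0: "h x \<noteq> 0" if "norm x \<le> R" for x using h(3)[of x] that by auto
    have hz: "h z \<noteq> 0" using h0 R by auto
    have bound: "norm (h x / h z) \<le> exp ((5 * R) powr s) / norm (f z)" if "norm x \<le> R" for x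
    proof -
      have "norm (h x) * 1 * norm (f z) \<le> norm (h x) * 2 ^ zero_count f R * norm (f z)"
        by (intro mult_right_mono mult_left_mono one_le_power) auto
      also have "\<dots> \<le> exp ((5 * R) powr s) * norm (h z)"
      proof (rule zero_free_part_bound[OF assms(1,2) R(6) _ h(1,2) R(7) that])
        fix \<zeta> :: complex assume "norm \<zeta> = 5 * R"
        then show "norm (f \<zeta>) \<le> exp ((5 * R) powr s)" using r0[of \<zeta>] R by simp
      qed
      finally show ?thesis using hz assms(6) by (simp add: norm_divide field_simps)
    qed
    obtain g0 where g0: "g0 holomorphic_on ball z (R / 2)"
      "\<And>x. x \<in> ball z (R / 2) \<Longrightarrow> exp (g0 x) = h x / h z"
    proof (rule holomorphic_logarithm_exists[of "ball z (R / 2)" "\<lambda>x. h x / h z" z])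
      show "(\<lambda>x. h x / h z) holomorphic_on ball z (R / 2)"
        using hz by (intro holomorphic_intros entire_holomorphic_on h) auto
      show "h x / h z \<noteq> 0" if "x \<in> ball z (R / 2)" for x
        using h0[OF ball[OF that]] hz by simp
    qed (use R in auto)
    define g where "g x = g0 x - g0 z" for x
    have g: "exp (g x) = h x / h z" if "x \<in> ball z (R / 2)" for x
      using g0(2)[OF that] g0(2)[of z] R(6) hz by (simp add: g_def exp_diff)
    have "norm (g u) \<le> 4 * A N * norm (u - z) / (R / 2)"
    proof (rule borel_caratheodory)
      show "g holomorphic_on ball z (R / 2)"
        unfolding g_def by (intro holomorphic_intros g0)
      fix x assume x: "x \<in> ball z (R / 2)"
      have "exp (Re (g x)) = norm (h x / h z)" by (simp flip: g[OF x])
      also have "\<dots> \<le> exp ((5 * R) powr s) / norm (f z)" by (rule bound[OF ball[OF x]])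
      also have "\<dots> = exp ((5 * R) powr s - ln (norm (f z)))"
        using assms(6) by (simp add: exp_diff)
      finally show "Re (g x) < A N" by (simp add: A_def R_def)
    qed (use R in \<open>auto simp: g_def d_def\<close>)
    moreover have "P N = f u / f z * exp (- g u)"
    proof -
      have "u \<in> ball z (R / 2)" using R by (simp add: d_def dist_norm norm_minus_commute)
      then have gu: "exp (- g u) = h z / h u" using g by (simp add: exp_minus)
      have "P N = (\<Prod>w\<in>?S. (u - w) ^ zero_mult f w) / (\<Prod>w\<in>?S. (z - w) ^ zero_mult f w)"
        by (simp add: P_def R_def power_divide prod_dividef)
      also have "\<dots> = (f u / h u) / (f z / h z)"
        using h0[OF R(4)] hz by (subst (2 4) h(2)) auto
      finally show ?thesis by (simp add: gu)
    qed
    ultimately show ?thesis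
      by (intro exI[of _ "- g u"]) (auto simp: d_def R_def)
  qed
  then have "\<forall>N. \<exists>\<gamma>. real N \<ge> Max {1, r0, 2 * norm z, norm u, 4 * d} \<longrightarrow>
      norm \<gamma> \<le> 8 * A N * d / N \<and> P N = f u / f z * exp \<gamma>"
    by blast
  then obtain \<gamma> where \<gamma>: "\<And>N. real N \<ge> Max {1, r0, 2 * norm z, norm u, 4 * d} \<Longrightarrow>
      norm (\<gamma> N) \<le> 8 * A N * d / N \<and> P N = f u / f z * exp (\<gamma> N)"
    by metis
  have ev: "\<forall>\<^sub>F N in sequentially. real N \<ge> Max {1, r0, 2 * norm z, norm u, 4 * d}"
    using filterlim_real_sequentially unfolding filterlim_at_top by blast
  have "(\<lambda>N. 8 * A N * d / real N) \<longlonglongrightarrow> 0"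
    unfolding A_def using assms(4,5) by real_asymp
  then have "\<gamma> \<longlonglongrightarrow> 0"
    by (rule Lim_null_comparison[rotated]) (use ev \<gamma> in \<open>auto elim: eventually_mono\<close>)
  then have "(\<lambda>N. f u / f z * exp (\<gamma> N)) \<longlonglongrightarrow> f u / f z * exp 0"
    by (intro tendsto_intros)
  then have "P \<longlonglongrightarrow> f u / f z * exp 0"
    by (rule Lim_transform_eventually) (use ev \<gamma> in \<open>auto elim!: eventually_mono\<close>)
  then show ?thesis unfolding P_def by simp
qed

section \<open>Shift quotients outside an exceptional set\<close>

text \<open>A nonzero integer weight is at least 1, so \<open>x w powr p\<close> is at most the
  whole sum \<open>T\<close>. Splitting \<open>x w\<close> into
  \<open>x w powr p * x w powr (1 - p)\<close>, the second factor is at most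
  \<open>T powr (1 / p - 1)\<close>.\<close>

lemma weighted_sum_le_powr_sum:
  fixes x :: "'a \<Rightarrow> real" and m :: "'a \<Rightarrow> nat"
  assumes "finite F" "\<And>w. w \<in> F \<Longrightarrow> x w \<ge> 0" "0 < p" "p < 1"
  shows "(\<Sum>w\<in>F. m w * x w) \<le> (\<Sum>w\<in>F. m w * x w powr p) powr (1 / p)"
proof -
  define T where "T = (\<Sum>w\<in>F. m w * x w powr p)"
  have "T \<ge> 0" unfolding T_def by (intro sum_nonneg) auto
  have "m w * x w \<le> m w * x w powr p * T powr (1 / p - 1)" if "w \<in> F" for w
  proof (cases "m w = 0 \<or> x w = 0")
    case False
    then have pos: "x w > 0" "m w \<ge> 1" using assms(2)[OF that] by auto
    have "1 * x w powr p \<le> m w * x w powr p"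
      using pos by (intro mult_right_mono) auto
    also have "\<dots> \<le> T"
      unfolding T_def by (rule member_le_sum) (use that assms in auto)
    finally have "(x w powr p) powr (1 / p - 1) \<le> T powr (1 / p - 1)"
      using assms by (intro powr_mono2) auto
    moreover have "p * (1 / p - 1) = 1 - p" using assms by (simp add: field_simps)
    ultimately have "x w powr (1 - p) \<le> T powr (1 / p - 1)"
      by (simp only: powr_powr)
    then have "x w powr p * x w powr (1 - p) \<le> x w powr p * T powr (1 / p - 1)"
      by (intro mult_left_mono) auto
    then have "x w \<le> x w powr p * T powr (1 / p - 1)"
      using pos by (simp flip: powr_add)
    then show ?thesis
      unfolding mult.assoc by (intro mult_left_mono) auto
  qed auto
  then have "(\<Sum>w\<in>F. m w * x w) \<le> (\<Sum>w\<in>F. m w * x w powr p * T powr (1 / p - 1))"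
    by (rule sum_mono)
  also have "\<dots> = T * T powr (1 / p - 1)"
    by (simp add: T_def sum_distrib_right)
  also have "\<dots> = T powr (1 / p)"
    using \<open>T \<ge> 0\<close> by (cases "T = 0") (auto simp: powr_diff)
  finally show ?thesis by (simp add: T_def)
qed

text \<open>A dyadic decomposition: a zero is charged \<open>c j\<close>, that is
  \<open>(2 powr (j - 1)) powr - t\<close>, for every disc of radius \<open>2 ^ j\<close> containing
  it. The smallest such disc already pays for its weight, and the overcounting is harmless because
  the \<open>j\<close>-th disc costs at most a constant times
  \<open>(2 powr (s - t)) ^ j\<close>.\<close>

lemma zero_weights_summable:
  assumes "entire f" "f \<noteq> (\<lambda>_. 0)" "growth_le f s" "0 < s" "s < t"
  shows "(\<integral>\<^sup>+w. ennreal (zero_mult f w * (1 + norm w) powr - t) \<partial>count_space {w. f w = 0}) < \<infinity>"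
proof -
  obtain C where C: "C \<ge> 0" "\<And>R. R \<ge> 1 \<Longrightarrow> real (zero_count f R) \<le> C * R powr s"
    using zero_count_bound[OF assms(1-4)] by blast
  define c where "c j = (2::real) powr t * 2 powr (- t * real j)" for j :: nat
  define g where "g j w = (if norm w \<le> 2 ^ j then ennreal (zero_mult f w * c j) else 0)" for j w
  let ?Z = "{w. f w = 0}"
  have "ennreal (zero_mult f w * (1 + norm w) powr - t) \<le> (\<Sum>j. g j w)" for w
  proof -
    obtain k where k: "norm w \<le> 2 ^ k"
      using real_arch_pow[of 2 "norm w"] by (auto intro: less_imp_le)
    define j where "j = (LEAST j. norm w \<le> 2 ^ j)"
    have j: "norm w \<le> 2 ^ j" unfolding j_def by (rule LeastI[of _ k]) (rule k)
    have "2 powr (real j - 1) \<le> 1 + norm w"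
    proof (cases j)
      case (Suc i)
      then have "\<not> norm w \<le> 2 ^ i"
        unfolding j_def using not_less_Least[of i "\<lambda>j. norm w \<le> 2 ^ j"] by auto
      then show ?thesis using Suc by (simp add: powr_realpow)
    qed (auto simp: powr_minus intro: order_trans[of _ 1])
    then have "(1 + norm w) powr - t \<le> (2 powr (real j - 1)) powr - t"
      using assms by (intro powr_mono2') auto
    also have "\<dots> = c j"
      by (simp add: c_def powr_powr algebra_simps flip: powr_add)
    finally have "ennreal (zero_mult f w * (1 + norm w) powr - t) \<le> g j w"
      using j by (auto simp: g_def intro!: ennreal_leI mult_left_mono)
    also have "g j w = (\<Sum>i\<in>{j}. g i w)" by simp
    also have "\<dots> \<le> (\<Sum>j. g j w)" by (rule sum_le_suminf) auto
    finally show ?thesis .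
  qed
  then have "(\<integral>\<^sup>+w. ennreal (zero_mult f w * (1 + norm w) powr - t) \<partial>count_space ?Z)
    \<le> (\<integral>\<^sup>+w. (\<Sum>j. g j w) \<partial>count_space ?Z)"
    by (intro nn_integral_mono)
  also have "\<dots> = (\<Sum>j. \<integral>\<^sup>+w. g j w \<partial>count_space ?Z)"
    by (rule nn_integral_suminf) auto
  also have "\<dots> \<le> (\<Sum>j. ennreal (2 powr t * C * (2 powr (s - t)) ^ j))"
  proof (rule suminf_le)
    fix j
    let ?A = "{w. norm w \<le> 2 ^ j \<and> f w = 0}"
    have "(\<integral>\<^sup>+w. g j w \<partial>count_space ?Z) = (\<Sum>w\<in>?A. g j w)"
      by (rule nn_integral_count_space')
        (use entire_finite_zeros[OF assms(1,2), of "2 ^ j"] in \<open>auto simp: g_def\<close>)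
    also have "\<dots> = (\<Sum>w\<in>?A. ennreal (zero_mult f w * c j))"
      by (intro sum.cong) (auto simp: g_def)
    also have "\<dots> = ennreal (zero_count f (2 ^ j) * c j)"
      by (subst sum_ennreal) (auto simp: c_def zero_count_def sum_distrib_right)
    also have "\<dots> \<le> ennreal (2 powr t * C * (2 powr (s - t)) ^ j)"
    proof (rule ennreal_leI)
      have "zero_count f (2 ^ j) * c j \<le> C * (2 ^ j) powr s * c j"
        by (intro mult_right_mono C) (auto simp: c_def)
      also have "\<dots> = 2 powr t * C * (2 powr (s - t)) ^ j"
        by (simp add: c_def algebra_simps powr_powr flip: powr_realpow powr_add)
      finally show "zero_count f (2 ^ j) * c j \<le> 2 powr t * C * (2 powr (s - t)) ^ j" .
    qed
    finally show "(\<integral>\<^sup>+w. g j w \<partial>count_space ?Z) \<le> ennreal (2 powr t * C * (2 powr (s - t)) ^ j)" .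
  qed auto
  also have "\<dots> < \<infinity>"
  proof -
    have "(2::real) powr (s - t) < 1"
      using assms powr_less_mono[of "s - t" 0 2] by simp
    then have "summable (\<lambda>j. 2 powr t * C * (2 powr (s - t)) ^ j)"
      by (intro summable_mult summable_geometric) auto
    then show ?thesis
      using C(1) by (subst suminf_ennreal2) auto
  qed
  finally show ?thesis .
qed

section \<open>Integrals of powers against a singular kernel\<close>

lemma nn_integral_powr_from_0_finite:
  fixes a :: real
  assumes "a > -1" "c \<ge> 0"
  shows "(\<integral>\<^sup>+x. ennreal (x powr a) * indicator {0..c} x \<partial>lborel) < \<infinity>"
  by (subst nn_integral_has_integral_lebesgue'[OF _ has_integral_powr_from_0[OF assms]]) auto

lemma nn_integral_powr_to_inf_finite:
  fixes a :: real
  assumes "a < -1" "c > 0"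
  shows "(\<integral>\<^sup>+x. ennreal (x powr a) * indicator {c..} x \<partial>lborel) < \<infinity>"
  by (subst nn_integral_has_integral_lebesgue'[OF _ has_integral_powr_to_inf[OF assms]]) auto

lemma nn_integral_powr_centre_1_finite:
  fixes p :: real
  assumes "p < 1"
  shows "(\<integral>\<^sup>+x. ennreal (\<bar>x - 1\<bar> powr - p) * indicator {0..2} x \<partial>lborel) < \<infinity>"
proof -
  define g where "g x = ennreal (x powr - p) * indicator {0..1} x" for x :: real
  have [measurable]: "g \<in> borel_measurable borel" unfolding g_def by measurable
  have fin: "(\<integral>\<^sup>+x. g x \<partial>lborel) < \<infinity>"
    unfolding g_def by (rule nn_integral_powr_from_0_finite) (use assms in auto)
  have "ennreal (\<bar>x - 1\<bar> powr - p) * indicator {0..2} x \<le> g (-1 + 1 * x) + g (1 + (-1) * x)" for x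
    by (cases "x \<ge> 1") (auto simp: g_def indicator_def)
  then have "(\<integral>\<^sup>+x. ennreal (\<bar>x - 1\<bar> powr - p) * indicator {0..2} x \<partial>lborel)
    \<le> (\<integral>\<^sup>+x. g (-1 + 1 * x) + g (1 + (-1) * x) \<partial>lborel)"
    by (rule nn_integral_mono)
  also have "\<dots> = (\<integral>\<^sup>+x. g (-1 + 1 * x) \<partial>lborel) + (\<integral>\<^sup>+x. g (1 + (-1) * x) \<partial>lborel)"
    by (rule nn_integral_add) measurable
  also have "\<dots> = (\<integral>\<^sup>+x. g x \<partial>lborel) + (\<integral>\<^sup>+x. g x \<partial>lborel)"
    using nn_integral_real_affine[of g 1 "-1"] nn_integral_real_affine[of g "-1" 1] by simp
  finally show ?thesis using fin by (simp add: order_le_less_trans)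
qed

text \<open>Each hypothesis answers for one critical point: \<open>0 < q\<close> for 0,
  \<open>p < 1\<close> for 1, and \<open>q < p\<close> for infinity. The cuts at 1/2 and 2 separate
  them.\<close>

lemma beta_kernel_finite:
  fixes p q :: real
  assumes "0 < q" "q < p" "p < 1"
  shows "(\<integral>\<^sup>+x. ennreal (\<bar>x - 1\<bar> powr - p * x powr (q - 1)) * indicator {0..} x \<partial>lborel) < \<infinity>"
proof -
  let ?f1 = "\<lambda>x. ennreal (x powr (q - 1)) * indicator {0..1/2} x"
  let ?f2 = "\<lambda>x. ennreal (\<bar>x - 1\<bar> powr - p) * indicator {0..2} x"
  let ?f3 = "\<lambda>x. ennreal (x powr (q - 1 - p)) * indicator {2..} x"
  let ?a = "ennreal (2 powr p)" and ?b = "ennreal (2 powr (1 - q))"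
  have "ennreal (\<bar>x - 1\<bar> powr - p * x powr (q - 1)) * indicator {0..} x
    \<le> ?a * ?f1 x + ?b * ?f2 x + ?a * ?f3 x" for x
  proof -
    consider "x < 0" | "0 \<le> x" "x \<le> 1/2" | "1/2 \<le> x" "x \<le> 2" | "x \<ge> 2" by linarith
    then show ?thesis
    proof cases
      case 2
      have "\<bar>x - 1\<bar> powr - p \<le> (1/2) powr - p"
        using 2 assms by (intro powr_mono2') auto
      then have "\<bar>x - 1\<bar> powr - p * x powr (q - 1) \<le> 2 powr p * x powr (q - 1)"
        by (intro mult_right_mono) (auto simp: powr_minus powr_divide)
      then have "ennreal (\<bar>x - 1\<bar> powr - p * x powr (q - 1)) \<le> ?a * ennreal (x powr (q - 1))"
        by (simp add: ennreal_leI flip: ennreal_mult')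
      also have "\<dots> = ?a * ?f1 x" using 2 by simp
      also have "\<dots> \<le> ?a * ?f1 x + ?b * ?f2 x + ?a * ?f3 x"
        by (simp add: add.assoc)
      finally show ?thesis using 2 by simp
    next
      case 3
      have "x powr (q - 1) \<le> (1/2) powr (q - 1)"
        using 3 assms by (intro powr_mono2') auto
      also have "\<dots> = 2 powr (1 - q)" by (simp add: powr_divide powr_diff)
      finally have "\<bar>x - 1\<bar> powr - p * x powr (q - 1) \<le> 2 powr (1 - q) * \<bar>x - 1\<bar> powr - p"
        by (simp add: mult.commute mult_right_mono)
      then have "ennreal (\<bar>x - 1\<bar> powr - p * x powr (q - 1)) \<le> ?b * ennreal (\<bar>x - 1\<bar> powr - p)"
        by (simp add: ennreal_leI flip: ennreal_mult')
      also have "\<dots> = ?b * ?f2 x" using 3 by simp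
      also have "\<dots> \<le> ?a * ?f1 x + ?b * ?f2 x + ?a * ?f3 x"
        by (simp add: add.assoc add_increasing)
      finally show ?thesis using 3 by simp
    next
      case 4
      have "\<bar>x - 1\<bar> powr - p \<le> (x / 2) powr - p"
        using 4 assms by (intro powr_mono2') auto
      also have "\<dots> = 2 powr p * x powr - p"
        using 4 by (simp add: powr_divide powr_minus field_simps)
      finally have "\<bar>x - 1\<bar> powr - p * x powr (q - 1) \<le> 2 powr p * x powr - p * x powr (q - 1)"
        by (intro mult_right_mono) auto
      also have "\<dots> = 2 powr p * x powr (q - 1 - p)"
        by (simp add: algebra_simps flip: powr_add)
      finally have "ennreal (\<bar>x - 1\<bar> powr - p * x powr (q - 1)) \<le> ?a * ennreal (x powr (q - 1 - p))"
        by (simp add: ennreal_leI flip: ennreal_mult')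
      also have "\<dots> = ?a * ?f3 x" using 4 by simp
      also have "\<dots> \<le> ?a * ?f1 x + ?b * ?f2 x + ?a * ?f3 x"
        by (simp add: add_increasing)
      finally show ?thesis using 4 by simp
    qed auto
  qed
  then have "(\<integral>\<^sup>+x. ennreal (\<bar>x - 1\<bar> powr - p * x powr (q - 1)) * indicator {0..} x \<partial>lborel)
    \<le> (\<integral>\<^sup>+x. ?a * ?f1 x + ?b * ?f2 x + ?a * ?f3 x \<partial>lborel)"
    by (rule nn_integral_mono)
  also have "\<dots> = ?a * (\<integral>\<^sup>+x. ?f1 x \<partial>lborel) + ?b * (\<integral>\<^sup>+x. ?f2 x \<partial>lborel) + ?a * (\<integral>\<^sup>+x. ?f3 x \<partial>lborel)"
    by (simp add: nn_integral_add nn_integral_cmult)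
  also have "\<dots> < \<infinity>"
    using nn_integral_powr_from_0_finite[of "q - 1" "1/2"] nn_integral_powr_centre_1_finite[of p]
      nn_integral_powr_to_inf_finite[of "q - 1 - p" 2] assms
    by (simp add: ennreal_mult_less_top)
  finally show ?thesis .
qed

text \<open>Substituting \<open>r = \<rho> * x\<close> produces \<open>\<rho> powr (q - p)\<close>
  times the integral for \<open>\<rho> = 1\<close>. That power blows up at 0, so for
  \<open>\<rho> < 1/2\<close> the estimate \<open>r - \<rho> \<ge> r / 2\<close> on
  \<open>r \<ge> 1\<close> takes over. The 3 comes from \<open>1 + \<rho> \<le> 3 * \<rho>\<close>
  in the first case.\<close>

lemma kernel_integral_bound:
  fixes p q :: real
  assumes "0 < q" "q < p" "p < 1"
  obtains C where "C \<ge> 0" "\<And>\<rho>. \<rho> \<ge> 0 \<Longrightarrow>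
    (\<integral>\<^sup>+r. ennreal (\<bar>r - \<rho>\<bar> powr - p * r powr (q - 1)) * indicator {1..} r \<partial>lborel)
      \<le> ennreal (C * (1 + \<rho>) powr (q - p))"
proof -
  define \<phi> where "\<phi> \<rho> r = ennreal (\<bar>r - \<rho>\<bar> powr - p * r powr (q - 1)) * indicator {0..} r" for \<rho> r
  have [measurable]: "\<phi> \<rho> \<in> borel_measurable borel" for \<rho> unfolding \<phi>_def by measurable
  define K1 where "K1 = enn2real (\<integral>\<^sup>+x. \<phi> 1 x \<partial>lborel)"
  have K1: "(\<integral>\<^sup>+x. \<phi> 1 x \<partial>lborel) = ennreal K1"
    unfolding K1_def \<phi>_def using beta_kernel_finite[OF assms] by simp
  define K2 where "K2 = enn2real (\<integral>\<^sup>+x. ennreal (x powr (q - 1 - p)) * indicator {1..} x \<partial>lborel)"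
  have K2: "(\<integral>\<^sup>+x. ennreal (x powr (q - 1 - p)) * indicator {1..} x \<partial>lborel) = ennreal K2"
    unfolding K2_def using nn_integral_powr_to_inf_finite[of "q - 1 - p" 1] assms by simp
  define C where "C = 3 powr (p - q) * (K1 + 2 powr p * K2)"
  have nonneg: "K1 \<ge> 0" "K2 \<ge> 0" by (auto simp: K1_def K2_def)
  show ?thesis
  proof (rule that[of C])
    show "C \<ge> 0" using nonneg by (simp add: C_def)
    fix \<rho> :: real assume "\<rho> \<ge> 0"
    show "(\<integral>\<^sup>+r. ennreal (\<bar>r - \<rho>\<bar> powr - p * r powr (q - 1)) * indicator {1..} r \<partial>lborel)
      \<le> ennreal (C * (1 + \<rho>) powr (q - p))"
    proof (cases "\<rho> \<ge> 1/2")
      case True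
      have "(\<integral>\<^sup>+r. ennreal (\<bar>r - \<rho>\<bar> powr - p * r powr (q - 1)) * indicator {1..} r \<partial>lborel)
        \<le> (\<integral>\<^sup>+r. \<phi> \<rho> r \<partial>lborel)"
        by (intro nn_integral_mono) (auto simp: \<phi>_def indicator_def)
      also have "\<dots> = ennreal \<rho> * (\<integral>\<^sup>+x. \<phi> \<rho> (\<rho> * x) \<partial>lborel)"
        using nn_integral_real_affine[of "\<phi> \<rho>" \<rho> 0] True by simp
      also have "(\<integral>\<^sup>+x. \<phi> \<rho> (\<rho> * x) \<partial>lborel)
        = (\<integral>\<^sup>+x. ennreal (\<rho> powr (q - 1 - p)) * \<phi> 1 x \<partial>lborel)"
      proof (intro nn_integral_cong)
        fix x :: real
        have "\<rho> * x - \<rho> = \<rho> * (x - 1)" by (simp add: algebra_simps)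
        moreover have "\<rho> powr - p * \<rho> powr (q - 1) = \<rho> powr (q - 1 - p)"
          by (simp add: algebra_simps flip: powr_add)
        ultimately show "\<phi> \<rho> (\<rho> * x) = ennreal (\<rho> powr (q - 1 - p)) * \<phi> 1 x"
          using True by (cases "x \<ge> 0")
            (auto simp: \<phi>_def indicator_def abs_mult powr_mult mult_ac zero_le_mult_iff
              simp flip: ennreal_mult')
      qed
      also have "\<dots> = ennreal (\<rho> powr (q - 1 - p)) * ennreal K1"
        by (simp add: nn_integral_cmult K1)
      also have "ennreal \<rho> * \<dots> = ennreal (\<rho> powr (q - p) * K1)"
        using True nonneg
        by (simp add: powr_diff mult_ac flip: ennreal_mult')
      also have "\<dots> \<le> ennreal (C * (1 + \<rho>) powr (q - p))"
      proof (rule ennreal_leI)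
        have "\<rho> powr (q - p) \<le> ((1 + \<rho>) / 3) powr (q - p)"
          using True assms by (intro powr_mono2') auto
        also have "\<dots> = 3 powr (p - q) * (1 + \<rho>) powr (q - p)"
          using True by (simp add: powr_divide powr_diff)
        finally have "\<rho> powr (q - p) * K1 \<le> 3 powr (p - q) * (1 + \<rho>) powr (q - p) * K1"
          using nonneg by (intro mult_right_mono)
        also have "\<dots> \<le> C * (1 + \<rho>) powr (q - p)"
          using nonneg by (simp add: C_def algebra_simps)
        finally show "\<rho> powr (q - p) * K1 \<le> C * (1 + \<rho>) powr (q - p)" .
      qed
      finally show ?thesis .
    next
      case False
      have "(\<integral>\<^sup>+r. ennreal (\<bar>r - \<rho>\<bar> powr - p * r powr (q - 1)) * indicator {1..} r \<partial>lborel)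
        \<le> (\<integral>\<^sup>+r. ennreal (2 powr p) * (ennreal (r powr (q - 1 - p)) * indicator {1..} r) \<partial>lborel)"
      proof (intro nn_integral_mono)
        fix r :: real
        show "ennreal (\<bar>r - \<rho>\<bar> powr - p * r powr (q - 1)) * indicator {1..} r
          \<le> ennreal (2 powr p) * (ennreal (r powr (q - 1 - p)) * indicator {1..} r)"
        proof (cases "r \<ge> 1")
          case True
          have "\<bar>r - \<rho>\<bar> powr - p \<le> (r / 2) powr - p"
            using True False assms by (intro powr_mono2') auto
          also have "\<dots> = 2 powr p * r powr - p"
            using True by (simp add: powr_divide powr_minus field_simps)
          finally have "\<bar>r - \<rho>\<bar> powr - p * r powr (q - 1) \<le> 2 powr p * r powr - p * r powr (q - 1)"
            by (intro mult_right_mono) auto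
          also have "\<dots> = 2 powr p * r powr (q - 1 - p)"
            by (simp add: algebra_simps flip: powr_add)
          finally show ?thesis using True by (simp add: ennreal_leI flip: ennreal_mult')
        qed auto
      qed
      also have "\<dots> = ennreal (2 powr p * K2)"
        using nonneg by (simp add: nn_integral_cmult K2 flip: ennreal_mult')
      also have "\<dots> \<le> ennreal (C * (1 + \<rho>) powr (q - p))"
      proof (rule ennreal_leI)
        have "1 = 3 powr (p - q) * 3 powr (q - p)"
          by (simp flip: powr_add)
        also have "\<dots> \<le> 3 powr (p - q) * (1 + \<rho>) powr (q - p)"
          using False \<open>\<rho> \<ge> 0\<close> assms by (intro mult_left_mono powr_mono2') auto
        finally have "1 * (K1 + 2 powr p * K2)
            \<le> 3 powr (p - q) * (1 + \<rho>) powr (q - p) * (K1 + 2 powr p * K2)"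
          using nonneg by (intro mult_right_mono) auto
        then show "2 powr p * K2 \<le> C * (1 + \<rho>) powr (q - p)"
          using nonneg by (simp add: C_def mult_ac)
      qed
      finally show ?thesis .
    qed
  qed
qed

section \<open>Sets of finite logarithmic measure\<close>

lemma finite_log_measure_Un:
  assumes "finite_log_measure A" "finite_log_measure B"
  shows "finite_log_measure (A \<union> B)"
proof -
  have [measurable]: "A \<in> sets lebesgue" "B \<in> sets lebesgue"
    "(\<lambda>r::real. ennreal (1 / r)) \<in> borel_measurable lebesgue"
    using assms by (auto simp: finite_log_measure_def intro!: measurable_completion)
  have "(\<integral>\<^sup>+r\<in>A \<union> B. ennreal (1 / r) \<partial>lebesgue)
    \<le> (\<integral>\<^sup>+r. ennreal (1 / r) * indicator A r + ennreal (1 / r) * indicator B r \<partial>lebesgue)"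
    by (intro nn_integral_mono) (auto simp: indicator_def)
  also have "\<dots> = (\<integral>\<^sup>+r\<in>A. ennreal (1 / r) \<partial>lebesgue) + (\<integral>\<^sup>+r\<in>B. ennreal (1 / r) \<partial>lebesgue)"
    by (rule nn_integral_add) measurable
  also have "\<dots> < \<infinity>" using assms by (simp add: finite_log_measure_def)
  finally show ?thesis using assms by (auto simp: finite_log_measure_def)
qed

lemma finite_log_measure_countable:
  assumes "countable A"
  shows "finite_log_measure (A \<inter> {1..})"
proof -
  have "countable (A \<inter> {1..})" using assms by blast
  then have null: "A \<inter> {1..} \<in> null_sets lborel" by (rule countable_imp_null_set_lborel)
  then have "A \<inter> {1..} \<in> null_sets lebesgue" by (rule null_sets_completionI)
  then have "(\<integral>\<^sup>+r\<in>A \<inter> {1..}. ennreal (1 / r) \<partial>lebesgue) = 0"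
    by (rule nn_integral_null_set)
  moreover have "A \<inter> {1..} \<in> sets lebesgue"
    using null by (auto dest: null_setsD2)
  ultimately show ?thesis by (simp add: finite_log_measure_def)
qed

lemma finite_log_measure_interval: "finite_log_measure {1..x}"
proof -
  have "(\<integral>\<^sup>+r\<in>{1..x}. ennreal (1 / r) \<partial>lebesgue) \<le> (\<integral>\<^sup>+r. indicator {1..x} r \<partial>lebesgue)"
    by (intro nn_integral_mono) (auto simp: indicator_def)
  also have "\<dots> < \<infinity>" by (simp add: emeasure_lborel_Icc_eq)
  finally show ?thesis by (auto simp: finite_log_measure_def)
qed

text \<open>The sum over the zeros of \<open>1 / \<bar>r - norm w\<bar>\<close> is not locally integrable in \<open>r\<close>, but for \<open>p < 1\<close>
  its \<open>p\<close>-th power is at most the sum of \<open>\<bar>r - norm w\<bar> powr - p\<close>, which is. Integrating the latter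
  against \<open>r powr (q - 1)\<close> gives \<open>(1 + norm w) powr (q - p)\<close> up to a constant, and this is summable
  since \<open>p - q = t * p > s\<close>.\<close>

lemma exceptional_set:
  assumes "entire f" "f \<noteq> (\<lambda>_. 0)" "growth_le f s" "0 < s" "s < t" "t < 1"
  obtains E where "finite_log_measure E"
    "\<And>r w. r \<ge> 1 \<Longrightarrow> r \<notin> E \<Longrightarrow> f w = 0 \<Longrightarrow> norm w \<noteq> r"
    "\<And>r F. r \<ge> 1 \<Longrightarrow> r \<notin> E \<Longrightarrow> finite F \<Longrightarrow> F \<subseteq> {w. f w = 0} \<Longrightarrow>
      (\<Sum>w\<in>F. zero_mult f w * (1 / \<bar>r - norm w\<bar>)) \<le> r powr (t - 1)"
proof -
  let ?Z = "{w. f w = 0}"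
  have Z: "countable ?Z" by (rule entire_countable_zeros[OF assms(1,2)])
  \<comment> \<open>The midpoint of \<open>s / t\<close> and 1, so that both \<open>p < 1\<close>
    and \<open>t * p > s\<close>. The choice of \<open>q\<close> makes \<open>- q / p\<close> equal
    to \<open>t - 1\<close>, the exponent claimed.\<close>
  define p where "p = (1 + s / t) / 2"
  define q where "q = (1 - t) * p"
  have p: "0 < p" "p < 1" using assms by (auto simp: p_def field_simps)
  have pt: "s < t * p" using assms by (auto simp: p_def field_simps)
  have q: "0 < q" "q < p" using p assms by (auto simp: q_def)
  obtain K where K: "K \<ge> 0" "\<And>\<rho>. \<rho> \<ge> 0 \<Longrightarrow>
    (\<integral>\<^sup>+r. ennreal (\<bar>r - \<rho>\<bar> powr - p * r powr (q - 1)) * indicator {1..} r \<partial>lborel)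
      \<le> ennreal (K * (1 + \<rho>) powr (q - p))"
    using kernel_integral_bound[OF q p(2)] by blast
  define h where
    "h w r = ennreal (zero_mult f w * (\<bar>r - norm w\<bar> powr - p * r powr (q - 1))) * indicator {1..} r"
    for w :: complex and r :: real
  have [measurable]: "h w \<in> borel_measurable borel" for w unfolding h_def by measurable
  define G where "G r = (\<integral>\<^sup>+w. h w r \<partial>count_space ?Z)" for r
  have [measurable]: "G \<in> borel_measurable borel"
    unfolding G_def
  proof (rule sigma_finite_measure.borel_measurable_nn_integral)
    show "sigma_finite_measure (count_space ?Z)"
      by (rule sigma_finite_measure_count_space_countable[OF Z])
    have "(\<lambda>x. h (snd x) (fst x)) \<in> borel_measurable (borel \<Otimes>\<^sub>M count_space ?Z)"
      by (rule measurable_compose_countable'[OF _ measurable_snd Z]) measurable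
    then show "(\<lambda>(r, w). h w r) \<in> borel_measurable (borel \<Otimes>\<^sub>M count_space ?Z)"
      by (simp add: case_prod_beta)
  qed
  have "(\<integral>\<^sup>+r. G r \<partial>lborel) = (\<integral>\<^sup>+w. \<integral>\<^sup>+r. h w r \<partial>lborel \<partial>count_space ?Z)"
    unfolding G_def by (rule nn_integral_count_space_nn_integral[OF Z]) measurable
  also have "\<dots> \<le> (\<integral>\<^sup>+w. ennreal K * ennreal (zero_mult f w * (1 + norm w) powr - (t * p)) \<partial>count_space ?Z)"
  proof (rule nn_integral_mono)
    fix w
    have "(\<integral>\<^sup>+r. h w r \<partial>lborel) = ennreal (zero_mult f w) *
      (\<integral>\<^sup>+r. ennreal (\<bar>r - norm w\<bar> powr - p * r powr (q - 1)) * indicator {1..} r \<partial>lborel)"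
      by (subst nn_integral_cmult[symmetric]) (auto simp: h_def[abs_def] ennreal_mult' mult.assoc)
    also have "\<dots> \<le> ennreal (zero_mult f w) * ennreal (K * (1 + norm w) powr (q - p))"
      by (intro mult_left_mono K) auto
    also have "q - p = - (t * p)" by (simp add: q_def algebra_simps)
    finally show "(\<integral>\<^sup>+r. h w r \<partial>lborel)
        \<le> ennreal K * ennreal (zero_mult f w * (1 + norm w) powr - (t * p))"
      using K(1) by (simp add: mult_ac flip: ennreal_mult')
  qed
  also have "\<dots> < \<infinity>"
    using zero_weights_summable[OF assms(1-4) pt]
    by (simp add: nn_integral_cmult ennreal_mult_less_top)
  finally have G_fin: "(\<integral>\<^sup>+r. G r \<partial>lborel) < \<infinity>" .
  \<comment> \<open>On this set \<open>G\<close> dominates \<open>1 / r\<close>, so integrability of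
    \<open>G\<close> bounds its logarithmic measure; off it the finite sums are below
    \<open>1 / r\<close>.\<close>
  define E0 where "E0 = {r. r \<ge> 1 \<and> ennreal (1 / r) \<le> G r}"
  have [measurable]: "E0 \<in> sets borel" unfolding E0_def by measurable
  have "finite_log_measure E0"
    unfolding finite_log_measure_def
  proof (intro conjI)
    show "E0 \<subseteq> {1..}" by (auto simp: E0_def)
    show "E0 \<in> sets lebesgue" by (simp add: sets_completionI_sets)
    have "(\<integral>\<^sup>+r\<in>E0. ennreal (1 / r) \<partial>lebesgue) \<le> (\<integral>\<^sup>+r. G r \<partial>lebesgue)"
      by (intro nn_integral_mono) (auto simp: E0_def indicator_def)
    then show "(\<integral>\<^sup>+r\<in>E0. ennreal (1 / r) \<partial>lebesgue) < \<infinity>"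
      using G_fin by (simp add: nn_integral_completion order_le_less_trans)
  qed
  \<comment> \<open>These radii have to be removed separately: since \<open>0 powr - p = 0\<close>,
    a zero on the circle contributes nothing to \<open>G\<close>.\<close>
  moreover have "finite_log_measure (norm ` ?Z \<inter> {1..})"
    using Z by (intro finite_log_measure_countable) auto
  ultimately have "finite_log_measure (E0 \<union> (norm ` ?Z \<inter> {1..}))"
    by (rule finite_log_measure_Un)
  then show ?thesis
  proof (rule that)
    fix r w assume "r \<ge> 1" "r \<notin> E0 \<union> (norm ` ?Z \<inter> {1..})" "f w = 0"
    then show "norm w \<noteq> r" by auto
  next
    fix r F assume r: "r \<ge> 1" "r \<notin> E0 \<union> (norm ` ?Z \<inter> {1..})" and F: "finite F" "F \<subseteq> ?Z"
    have ne: "r \<noteq> norm w" if "w \<in> F" for w using r F that by auto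
    define T where "T = (\<Sum>w\<in>F. zero_mult f w * (1 / \<bar>r - norm w\<bar>) powr p)"
    have "ennreal (T * r powr (q - 1)) = (\<Sum>w\<in>F. h w r)"
      unfolding T_def sum_distrib_right using ne r
      by (subst sum_ennreal[symmetric])
        (auto simp: h_def powr_minus powr_divide field_simps intro!: sum.cong)
    also have "\<dots> = (\<integral>\<^sup>+w. h w r * indicator F w \<partial>count_space ?Z)"
      by (subst nn_integral_count_space'[OF F(1) _ F(2)]) auto
    also have "\<dots> \<le> G r"
      unfolding G_def by (intro nn_integral_mono) (auto simp: indicator_def)
    also have "\<dots> < ennreal (1 / r)" using r by (auto simp: E0_def)
    finally have "T * r powr (q - 1) < 1 / r"
      using r by (subst (asm) ennreal_less_iff) (auto simp: T_def intro!: mult_nonneg_nonneg sum_nonneg)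
    moreover have "1 / r = r powr - q * r powr (q - 1)"
      using r by (simp add: powr_diff powr_minus_divide)
    ultimately have "T < r powr - q" using r by simp
    then have "T powr (1 / p) \<le> (r powr - q) powr (1 / p)"
      using p by (intro powr_mono2) (auto simp: T_def intro!: sum_nonneg)
    also have "\<dots> = r powr (t - 1)"
      using p by (simp add: powr_powr q_def)
    finally show "(\<Sum>w\<in>F. zero_mult f w * (1 / \<bar>r - norm w\<bar>)) \<le> r powr (t - 1)"
      using weighted_sum_le_powr_sum[OF F(1) _ p, of "\<lambda>w. 1 / \<bar>r - norm w\<bar>" "zero_mult f"]
      unfolding T_def by simp
  qed
qed

text \<open>Bounds of the form \<open>exp a - 1\<close> are stable under products, with exponents
  adding up; this carries the estimate of a single factor to powers and to finite products over
  zeros.\<close>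

lemma norm_mult_minus1_le_exp:
  fixes x y :: complex
  assumes "norm (x - 1) \<le> exp a - 1" "norm (y - 1) \<le> exp b - 1"
  shows "norm (x * y - 1) \<le> exp (a + b) - 1"
proof -
  have "norm y \<le> exp b" using assms(2) norm_triangle_sub[of y 1] by simp
  have "x * y - 1 = (x - 1) * y + (y - 1)" by (simp add: algebra_simps)
  also have "norm \<dots> \<le> norm (x - 1) * norm y + norm (y - 1)"
    by (rule norm_triangle_le) (simp add: norm_mult)
  also have "\<dots> \<le> (exp a - 1) * exp b + (exp b - 1)"
    using assms \<open>norm y \<le> exp b\<close> order_trans[OF norm_ge_zero assms(1)]
    by (intro add_mono mult_mono) auto
  finally show ?thesis by (simp add: exp_add algebra_simps)
qed

lemma norm_power_minus1_le_exp:
  fixes x :: complex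
  assumes "norm (x - 1) \<le> exp a - 1"
  shows "norm (x ^ n - 1) \<le> exp (n * a) - 1"
proof (induction n)
  case (Suc n)
  show ?case using norm_mult_minus1_le_exp[OF assms Suc] by (simp add: algebra_simps)
qed auto

lemma norm_prod_minus1_le_exp:
  fixes x :: "'a \<Rightarrow> complex"
  assumes "\<And>w. w \<in> F \<Longrightarrow> norm (x w - 1) \<le> exp (a w) - 1"
  shows "norm ((\<Prod>w\<in>F. x w) - 1) \<le> exp (\<Sum>w\<in>F. a w) - 1"
  using assms
proof (induction F rule: infinite_finite_induct)
  case (insert w F)
  then show ?case using norm_mult_minus1_le_exp[of "x w" "a w"] by simp
qed auto

text \<open>Since \<open>norm (z - w)\<close> is at least the difference of the moduli, all partial
  products obey the one bound \<open>exp \<sigma> - 1\<close>, which survives the limit. The 2 comes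
  from \<open>exp \<sigma> \<le> 1 + \<sigma> + \<sigma> ^ 2\<close> and
  \<open>\<sigma> \<le> 1\<close>.\<close>

lemma shift_quotient_bound:
  assumes "entire f" "f \<noteq> (\<lambda>_. 0)" "growth_le f s" "0 < s" "s < t" "t < 1"
  obtains E where "finite_log_measure E"
    "\<And>z. norm z \<ge> 1 \<Longrightarrow> norm z \<notin> E \<Longrightarrow> f z \<noteq> 0"
    "\<And>z. norm z \<ge> 1 \<Longrightarrow> norm z \<notin> E \<Longrightarrow> norm (f (z + 1) / f z - 1) \<le> 2 * norm z powr (t - 1)"
proof -
  obtain E where E: "finite_log_measure E"
    "\<And>r w. r \<ge> 1 \<Longrightarrow> r \<notin> E \<Longrightarrow> f w = 0 \<Longrightarrow> norm w \<noteq> r"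
    "\<And>r F. r \<ge> 1 \<Longrightarrow> r \<notin> E \<Longrightarrow> finite F \<Longrightarrow> F \<subseteq> {w. f w = 0} \<Longrightarrow>
      (\<Sum>w\<in>F. zero_mult f w * (1 / \<bar>r - norm w\<bar>)) \<le> r powr (t - 1)"
    using exceptional_set[OF assms] by blast
  show ?thesis
  proof (rule that[OF E(1)])
    fix z :: complex assume z: "norm z \<ge> 1" "norm z \<notin> E"
    show nz: "f z \<noteq> 0" using E(2)[OF z] by auto
    define \<sigma> where "\<sigma> = norm z powr (t - 1)"
    have "\<sigma> \<ge> 0" by (simp add: \<sigma>_def)
    moreover have "\<sigma> \<le> 1" using powr_mono[of "t - 1" 0 "norm z"] z assms by (auto simp: \<sigma>_def split: if_splits)
    ultimately have "\<sigma>\<^sup>2 \<le> \<sigma>" by (simp add: power2_eq_square mult_left_le)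
    with exp_bound[OF \<open>\<sigma> \<ge> 0\<close> \<open>\<sigma> \<le> 1\<close>] have exp_\<sigma>: "exp \<sigma> - 1 \<le> 2 * \<sigma>" by simp
    have "norm ((\<Prod>w | norm w \<le> real N \<and> f w = 0. ((z + 1 - w) / (z - w)) ^ zero_mult f w) - 1)
      \<le> 2 * \<sigma>" (is "norm ((\<Prod>w\<in>?F. _) - 1) \<le> _") for N
    proof -
      have "norm ((\<Prod>w\<in>?F. ((z + 1 - w) / (z - w)) ^ zero_mult f w) - 1)
        \<le> exp (\<Sum>w\<in>?F. zero_mult f w * (1 / norm (z - w))) - 1"
      proof (intro norm_prod_minus1_le_exp norm_power_minus1_le_exp)
        fix w assume "w \<in> ?F"
        then have "z \<noteq> w" using nz by auto
        then have "(z + 1 - w) / (z - w) - 1 = 1 / (z - w)" by (simp add: field_simps)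
        then have "norm ((z + 1 - w) / (z - w) - 1) = 1 / norm (z - w)"
          by (simp add: norm_divide)
        then show "norm ((z + 1 - w) / (z - w) - 1) \<le> exp (1 / norm (z - w)) - 1"
          using exp_ge_add_one_self[of "1 / norm (z - w)"] by linarith
      qed
      also have "(\<Sum>w\<in>?F. zero_mult f w * (1 / norm (z - w)))
        \<le> (\<Sum>w\<in>?F. zero_mult f w * (1 / \<bar>norm z - norm w\<bar>))"
      proof (intro sum_mono mult_left_mono divide_left_mono)
        fix w assume "w \<in> ?F"
        then have "norm w \<noteq> norm z" "z \<noteq> w" using E(2)[OF z] nz by auto
        then show "0 < norm (z - w) * \<bar>norm z - norm w\<bar>" by simp
        show "\<bar>norm z - norm w\<bar> \<le> norm (z - w)" by (rule norm_triangle_ineq3)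
      qed auto
      also have "\<dots> \<le> \<sigma>"
        unfolding \<sigma>_def by (rule E(3)[OF z entire_finite_zeros[OF assms(1,2)]]) auto
      finally show ?thesis using exp_\<sigma> by simp
    qed
    moreover have "(\<lambda>N::nat. norm ((\<Prod>w | norm w \<le> real N \<and> f w = 0.
        ((z + 1 - w) / (z - w)) ^ zero_mult f w) - 1)) \<longlonglongrightarrow> norm (f (z + 1) / f z - 1)"
      by (intro tendsto_intros quotient_as_limit_of_zero_products[OF assms(1-4) _ nz])
        (use assms in auto)
    ultimately show "norm (f (z + 1) / f z - 1) \<le> 2 * norm z powr (t - 1)"
      unfolding \<sigma>_def by (intro LIMSEQ_le_const2) auto
  qed
qed

section \<open>Jensen's formula\<close>

definition circle_mean :: "(complex \<Rightarrow> real) \<Rightarrow> real \<Rightarrow> real" where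
  "circle_mean u r = 1 / (2 * pi) * integral {0..2 * pi} (\<lambda>\<theta>. u (of_real r * cis \<theta>))"

text \<open>By compactness the zero-free closed disc extends to a larger open one, where
  \<open>h\<close> has a holomorphic logarithm. Cauchy's formula at the centre gives the mean value
  property, and real parts give the claim.\<close>

lemma circle_mean_ln_norm_nonvanishing:
  assumes "entire h" "r > 0" "\<And>z. norm z \<le> r \<Longrightarrow> h z \<noteq> 0"
  shows "circle_mean (\<lambda>z. ln (norm (h z))) r = ln (norm (h 0))"
proof -
  have "closed {z. h z = 0}"
    using closed_Collect_eq[OF entire_continuous_on[OF assms(1)] continuous_on_const] by simp
  moreover have "cball 0 r \<inter> {z. h z = 0} = {}" using assms(3) by auto
  ultimately have "\<exists>d>0. \<forall>x\<in>cball 0 r. \<forall>y\<in>{z. h z = 0}. d \<le> dist x y"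
    by (intro separate_compact_closed compact_cball)
  then obtain d where d: "d > 0" "\<And>x y. x \<in> cball 0 r \<Longrightarrow> h y = 0 \<Longrightarrow> d \<le> dist x y"
    by auto
  have nz: "h z \<noteq> 0" if "z \<in> ball 0 (r + d)" for z
  proof (cases "norm z \<le> r")
    case False
    \<comment> \<open>The radial projection of \<open>z\<close> onto the circle.\<close>
    define x where "x = of_real (r / norm z) * z"
    have "z \<noteq> 0" using False assms(2) by force
    have "norm x = r" using \<open>z \<noteq> 0\<close> assms(2) by (simp add: x_def norm_mult norm_divide)
    have "x - z = of_real (r / norm z - 1) * z" by (simp add: x_def algebra_simps)
    then have "dist x z = \<bar>r / norm z - 1\<bar> * norm z"
      by (simp only: dist_norm norm_mult norm_of_real)
    also have "\<dots> = norm z - r"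
      using False assms(2) \<open>z \<noteq> 0\<close> by (simp add: abs_if field_simps)
    also have "\<dots> < d" using that by simp
    finally show ?thesis using d(2)[of x z] \<open>norm x = r\<close> by auto
  qed (use assms(3) in auto)
  obtain g where g: "g holomorphic_on ball 0 (r + d)"
    "\<And>x. x \<in> ball 0 (r + d) \<Longrightarrow> exp (g x) = h x"
    using holomorphic_logarithm_exists[of "ball 0 (r + d)" h 0] nz assms d
    by (auto intro: entire_holomorphic_on)
  have Re_g: "Re (g z) = ln (norm (h z))" if "z \<in> ball 0 (r + d)" for z
    by (simp flip: g(2)[OF that])
  have "((\<lambda>u. g u / (u - 0)) has_contour_integral (2 * of_real pi * \<i> * g 0)) (circlepath 0 r)"
    by (rule Cauchy_integral_circlepath_simple)
      (use assms d in \<open>auto intro: holomorphic_on_subset[OF g(1)]\<close>)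
  then have "((\<lambda>\<theta>. g (0 + r * cis \<theta>) / (0 + r * cis \<theta> - 0) * r * \<i> * cis \<theta>)
    has_integral (2 * of_real pi * \<i> * g 0)) {0..2 * pi}"
    unfolding circlepath_def by (subst (asm) has_contour_integral_part_circlepath_iff) auto
  then have "((\<lambda>\<theta>. - \<i> * (g (0 + r * cis \<theta>) / (0 + r * cis \<theta> - 0) * r * \<i> * cis \<theta>))
    has_integral (- \<i> * (2 * of_real pi * \<i> * g 0))) {0..2 * pi}"
    by (rule has_integral_mult_right)
  moreover have "(\<lambda>\<theta>. - \<i> * (g (0 + r * cis \<theta>) / (0 + r * cis \<theta> - 0) * r * \<i> * cis \<theta>))
      = (\<lambda>\<theta>. g (r * cis \<theta>))"
    using assms(2) by (intro ext) (simp add: field_simps)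
  moreover have "- \<i> * (2 * of_real pi * \<i> * g 0) = of_real (2 * pi) * g 0"
    by simp
  ultimately have "((\<lambda>\<theta>. g (r * cis \<theta>)) has_integral (of_real (2 * pi) * g 0)) {0..2 * pi}"
    by (simp only:)
  then have "((\<lambda>\<theta>. Re (g (r * cis \<theta>))) has_integral Re (of_real (2 * pi) * g 0)) {0..2 * pi}"
    by (rule has_integral_Re)
  moreover have "Re (g (r * cis \<theta>)) = ln (norm (h (r * cis \<theta>)))" for \<theta>
    using assms(2) d(1) by (intro Re_g) (auto simp: norm_mult)
  moreover have "Re (of_real (2 * pi) * g 0) = 2 * pi * ln (norm (h 0))"
    using Re_g[of 0] assms(2) d(1) by simp
  ultimately have "((\<lambda>\<theta>. ln (norm (h (r * cis \<theta>)))) has_integral 2 * pi * ln (norm (h 0))) {0..2 * pi}"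
    by simp
  then show ?thesis by (simp add: circle_mean_def integral_unique)
qed

text \<open>The zero at the origin is covered by \<open>ln 0 = 0\<close>.\<close>

definition Nzeros :: "(complex \<Rightarrow> complex) \<Rightarrow> real \<Rightarrow> real" where
  "Nzeros f r = (\<Sum>w | norm w \<le> r \<and> f w = 0. zero_mult f w * (ln r - ln (norm w)))"

text \<open>In Jensen's formula \<open>S\<close> and \<open>h\<close> depend on the radius, whereas
  \<open>g 0\<close> does not; this identity makes the constant there independent of
  \<open>r\<close>. The two cofactors agree off 0, hence at 0 by continuity.\<close>

lemma leading_coefficient_from_zeros:
  assumes "entire f" "entire g" "g 0 \<noteq> 0" "\<And>z. f z = z ^ zero_mult f 0 * g z"
    and S: "finite S" "0 \<in> S \<or> f 0 \<noteq> 0"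
    and h: "entire h" "\<And>z. f z = (\<Prod>w\<in>S. (z - w) ^ zero_mult f w) * h z"
  shows "g 0 = (\<Prod>w\<in>S - {0}. (- w) ^ zero_mult f w) * h 0"
proof -
  define k where "k z = (\<Prod>w\<in>S - {0}. (z - w) ^ zero_mult f w) * h z" for z
  have f_eq: "f z = z ^ zero_mult f 0 * k z" for z
  proof (cases "0 \<in> S")
    case True
    then show ?thesis
      using h(2)[of z] S(1) by (simp add: k_def prod.remove mult_ac)
  next
    case False
    then show ?thesis
      using h(2)[of z] S zero_mult_eq_0[OF assms(1), of 0] by (simp add: k_def)
  qed
  have "entire k" unfolding k_def by (intro entire_mult entire_prod_linear_powers h)
  have "(\<lambda>z. g z - k z) \<midarrow>0\<rightarrow> g 0 - k 0"
    using entire_continuous_on[OF entire_diff[OF assms(2) \<open>entire k\<close>], of UNIV]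
    by (simp add: continuous_on_def)
  moreover have "(\<lambda>z. g z - k z) \<midarrow>0\<rightarrow> 0"
  proof (rule tendsto_eventually)
    have "g z = k z" if "z \<noteq> 0" for z
      using assms(4)[of z] f_eq[of z] that by simp
    then show "\<forall>\<^sub>F z in at 0. g z - k z = 0"
      by (auto simp: eventually_at_filter)
  qed
  ultimately have "g 0 - k 0 = 0" by (rule LIM_unique)
  then show ?thesis by (simp add: k_def)
qed

text \<open>Replacing each factor \<open>z - w\<close> by \<open>r - cnj w * z / r\<close>, which has the same
  modulus on the circle but no zero in the disc, reduces the claim to the mean value property.\<close>

lemma jensen_formula:
  assumes "entire f" "f \<noteq> (\<lambda>_. 0)"
  obtains K where "\<And>r. r > 0 \<Longrightarrow> (\<And>z. norm z = r \<Longrightarrow> f z \<noteq> 0) \<Longrightarrow>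
    circle_mean (\<lambda>z. ln (norm (f z))) r = Nzeros f r + K"
proof -
  obtain g where g: "entire g" "g 0 \<noteq> 0" "\<And>z. f z = (z - 0) ^ zero_mult f 0 * g z"
    using zero_mult_factor[OF assms] by blast
  have g': "f z = z ^ zero_mult f 0 * g z" for z using g(3)[of z] by simp
  show ?thesis
  proof (rule that[of "ln (norm (g 0))"])
    fix r :: real assume r: "r > 0" "\<And>z. norm z = r \<Longrightarrow> f z \<noteq> 0"
    define S where "S = {w. norm w \<le> r \<and> f w = 0}"
    have S: "finite S" "\<And>w. w \<in> S \<Longrightarrow> norm w < r"
      using entire_finite_zeros[OF assms] r(2) by (auto simp: S_def less_le)
    obtain h where h: "entire h" "\<And>z. f z = (\<Prod>w\<in>S. (z - w) ^ zero_mult f w) * h z"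
      "\<And>z. h z = 0 \<longleftrightarrow> z \<notin> S \<and> f z = 0"
      using entire_factor_zeros[OF assms S(1)] by blast
    have h_nz: "h z \<noteq> 0" if "norm z \<le> r" for z using that h(3)[of z] by (auto simp: S_def)
    define H where "H z = (\<Prod>w\<in>S. (r - cnj w * z / r) ^ zero_mult f w) * h z" for z
    have "entire H"
      using h(1) r(1) unfolding H_def entire_def by (intro holomorphic_intros) auto
    have H_nz: "H z \<noteq> 0" if "norm z \<le> r" for z
    proof -
      have "r - cnj w * z / r \<noteq> 0" if "w \<in> S" for w
      proof
        assume "r - cnj w * z / r = 0"
        then have "complex_of_real r * r = cnj w * z" using r(1) by (simp add: field_simps)
        then have "norm (complex_of_real r * r) = norm (cnj w * z)" by (rule arg_cong)
        then have "r * r = norm w * norm z" using r(1) by (simp add: norm_mult)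
        also have "\<dots> < r * r"
          using S(2)[OF that] \<open>norm z \<le> r\<close> r(1)
          by (meson mult_le_cancel_left_pos mult_less_cancel_right_pos norm_ge_zero order_le_less_trans mult_left_mono)
        finally show False by simp
      qed
      then show ?thesis using h_nz[OF that] S(1) by (simp add: H_def)
    qed
    have norm_H: "norm (H z) = norm (f z)" if z: "norm z = r" for z
    proof -
      have "norm (r - cnj w * z / r) = norm (z - w)" for w
      proof -
        have "z * cnj z = of_real (r * r)"
          using z by (metis complex_norm_square power2_eq_square)
        then have "z * (cnj z - cnj w) = r * (r - cnj w * z / r)"
          using r(1) by (simp add: field_simps)
        then have "norm (z * cnj (z - w)) = norm (r * (r - cnj w * z / r))"
          by simp
        then have "r * norm (z - w) = r * norm (r - cnj w * z / r)"
          using r(1) z by (simp only: norm_mult complex_mod_cnj norm_of_real abs_of_pos)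
        then show ?thesis using r(1) by simp
      qed
      then show ?thesis
        by (subst h(2)) (simp add: H_def norm_mult norm_power flip: prod_norm)
    qed
    have "circle_mean (\<lambda>z. ln (norm (f z))) r = circle_mean (\<lambda>z. ln (norm (H z))) r"
      using r(1) by (simp add: circle_mean_def norm_H norm_mult)
    also have "\<dots> = ln (norm (H 0))"
      by (rule circle_mean_ln_norm_nonvanishing[OF \<open>entire H\<close> r(1) H_nz])
    also have "\<dots> = (\<Sum>w\<in>S. zero_mult f w * ln r) + ln (norm (h 0))"
    proof -
      have "norm (H 0) = (\<Prod>w\<in>S. r ^ zero_mult f w) * norm (h 0)"
        using r(1) by (simp add: H_def norm_mult norm_power flip: prod_norm)
      then show ?thesis
        using r(1) h_nz[of 0] S(1) by (simp add: ln_mult prod_pos ln_prod ln_realpow)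
    qed
    also have "ln (norm (h 0)) = ln (norm (g 0)) - (\<Sum>w\<in>S - {0}. zero_mult f w * ln (norm w))"
    proof -
      have "0 \<in> S \<or> f 0 \<noteq> 0" using r(1) by (auto simp: S_def)
      then have "g 0 = (\<Prod>w\<in>S - {0}. (- w) ^ zero_mult f w) * h 0"
        by (rule leading_coefficient_from_zeros[OF assms(1) g(1,2) g' S(1) _ h(1,2)])
      then have "norm (g 0) = (\<Prod>w\<in>S - {0}. norm w ^ zero_mult f w) * norm (h 0)"
        by (simp add: norm_mult norm_power flip: prod_norm)
      moreover have "ln (\<Prod>w\<in>S - {0}. norm w ^ zero_mult f w)
        = (\<Sum>w\<in>S - {0}. zero_mult f w * ln (norm w))"
        using S(1) by (subst ln_prod) (auto simp: ln_realpow intro!: sum.cong)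
      ultimately show ?thesis
        using r(1) h_nz[of 0] S(1) by (simp add: ln_mult)
    qed
    also have "(\<Sum>w\<in>S - {0}. zero_mult f w * ln (norm w)) = (\<Sum>w\<in>S. zero_mult f w * ln (norm w))"
      using S(1) by (intro sum.mono_neutral_left) auto
    finally show "circle_mean (\<lambda>z. ln (norm (f z))) r = Nzeros f r + ln (norm (g 0))"
      by (simp add: Nzeros_def S_def right_diff_distrib sum_subtractf)
  qed
qed

section \<open>The shift counting function\<close>

text \<open>An adjacent pair does not fit into a small disc about the origin, so it is counted only
  from a positive radius on and leaves \<open>nbar_delta\<close> at 0 unaffected.\<close>

lemma max_norm_shift_ge_half: "max (norm w) (norm (w - 1 :: complex)) \<ge> 1/2"
  using norm_triangle_ineq4[of w "w - 1"] by simp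

lemma has_integral_step_over_t:
  fixes c s r :: real
  assumes "0 < s" "0 < r"
  shows "((\<lambda>t. if s \<le> t then c / t else 0) has_integral
    (if s \<le> r then c * (ln r - ln s) else 0)) {0..r}"
proof (cases "s \<le> r")
  case True
  have "((\<lambda>t. 1 / t) has_integral (ln r - ln s)) {s..r}"
  proof (rule fundamental_theorem_of_calculus[OF True])
    fix t assume "t \<in> {s..r}"
    then show "(ln has_vector_derivative 1 / t) (at t within {s..r})"
      using assms by (auto simp flip: has_real_derivative_iff_has_vector_derivative
          intro!: derivative_eq_intros)
  qed
  then have "((\<lambda>t. c * (1 / t)) has_integral (c * (ln r - ln s))) {s..r}"
    by (rule has_integral_mult_right)
  then have "((\<lambda>t. if t \<in> {s..r} then c * (1 / t) else 0) has_integral (c * (ln r - ln s))) {0..r}"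
    using assms by (subst has_integral_restrict) auto
  then show ?thesis
    using True by (auto elim!: has_integral_eq[rotated])
next
  case False
  then show ?thesis by (auto intro!: has_integral_is_0)
qed

text \<open>The index set becomes independent of \<open>t\<close>, which permits termwise
  integration: a zero switches on at \<open>norm w\<close>, an adjacent pair at the larger of its
  two moduli.\<close>

lemma nbar_delta_eq_sum:
  assumes "entire f" "f \<noteq> (\<lambda>_. 0)" "finite S"
    and S: "\<And>w. norm w \<le> r \<Longrightarrow> f w = 0 \<Longrightarrow> w \<in> S" and "t \<le> r"
  shows "nbar_delta f t = (\<Sum>w\<in>S. (if norm w \<le> t then real (zero_mult f w) else 0)
    - (if max (norm w) (norm (w - 1)) \<le> t
       then real (min (zero_mult f w) (zero_mult f (w - 1))) else 0))"
  unfolding nbar_delta_def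
proof (rule sum.mono_neutral_cong_left)
  show "{w. norm w \<le> t \<and> 0 < zero_mult f w} \<subseteq> S"
    using S \<open>t \<le> r\<close> zero_mult_pos_iff[OF assms(1,2)] by auto
qed (use assms(3) in auto)

text \<open>Step functions are integrated term by term. A zero at the origin is cancelled from the
  integrand and comes back as its multiplicity times \<open>ln r\<close>, in accordance with
  \<open>ln 0 = 0\<close>.\<close>

lemma Nbar_delta_eq_sum:
  assumes f: "entire f" "f \<noteq> (\<lambda>_. 0)" and r: "r > 0"
    and S: "finite S" "\<And>w. norm w \<le> r \<Longrightarrow> f w = 0 \<Longrightarrow> w \<in> S" "\<And>w. w \<in> S \<Longrightarrow> norm w \<le> r"
  shows "Nbar_delta f r = (\<Sum>w\<in>S. zero_mult f w * (ln r - ln (norm w))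
    - (if norm (w - 1) \<le> r
       then min (zero_mult f w) (zero_mult f (w - 1)) * (ln r - ln (max (norm w) (norm (w - 1))))
       else 0))"
proof -
  define \<mu> where "\<mu> w = real (min (zero_mult f w) (zero_mult f (w - 1)))" for w
  define m where "m w = max (norm w) (norm (w - 1))" for w :: complex
  have m: "m w > 0" for w using max_norm_shift_ge_half[of w] by (simp add: m_def)
  have nbar: "nbar_delta f t = (\<Sum>w\<in>S. (if norm w \<le> t then real (zero_mult f w) else 0)
    - (if m w \<le> t then \<mu> w else 0))" if "t \<le> r" for t
    using nbar_delta_eq_sum[OF f S(1,2) that] unfolding \<mu>_def m_def .
  have nbar0: "nbar_delta f 0 = (\<Sum>w\<in>S. if w = 0 then real (zero_mult f w) else 0)"
    using m by (subst nbar) (use r in \<open>auto intro!: sum.cong simp: not_le[symmetric]\<close>)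
  define F where "F w t = (if w = 0 then 0 else if norm w \<le> t then real (zero_mult f w) / t else 0)
    - (if m w \<le> t then \<mu> w / t else 0)" for w t
  define I where "I w = (if w = 0 then 0 else zero_mult f w * (ln r - ln (norm w)))
    - (if m w \<le> r then \<mu> w * (ln r - ln (m w)) else 0)" for w
  have "(F w has_integral I w) {0..r}" if "w \<in> S" for w
    unfolding F_def[abs_def] I_def
  proof (rule has_integral_diff)
    show "((\<lambda>t. if m w \<le> t then \<mu> w / t else 0) has_integral
        (if m w \<le> r then \<mu> w * (ln r - ln (m w)) else 0)) {0..r}"
      by (rule has_integral_step_over_t[OF m r])
    show "((\<lambda>t. if w = 0 then 0 else if norm w \<le> t then real (zero_mult f w) / t else 0)
        has_integral (if w = 0 then 0 else zero_mult f w * (ln r - ln (norm w)))) {0..r}"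
      using has_integral_step_over_t[of "norm w" r "real (zero_mult f w)"] r S(3)[OF that]
      by (cases "w = 0") auto
  qed
  then have "((\<lambda>t. \<Sum>w\<in>S. F w t) has_integral (\<Sum>w\<in>S. I w)) {0..r}"
    by (intro has_integral_sum S)
  moreover have "(\<Sum>w\<in>S. F w t) = (nbar_delta f t - nbar_delta f 0) / t" if "t \<in> {0..r}" for t
  proof (cases "t = 0")
    case False
    then have "t > 0" "t \<le> r" using that by auto
    then show ?thesis
      unfolding nbar0 nbar[OF \<open>t \<le> r\<close>] sum_subtractf[symmetric] sum_divide_distrib
      by (intro sum.cong) (auto simp: F_def diff_divide_distrib)
  qed (use m in \<open>auto simp: F_def not_le[symmetric] intro!: sum.neutral\<close>)
  ultimately have "((\<lambda>t. (nbar_delta f t - nbar_delta f 0) / t) has_integral (\<Sum>w\<in>S. I w)) {0..r}"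
    by (rule has_integral_eq[rotated])
  then have "Nbar_delta f r = (\<Sum>w\<in>S. I w + (if w = 0 then real (zero_mult f w) else 0) * ln r)"
    unfolding Nbar_delta_def by (simp add: integral_unique nbar0 sum.distrib sum_distrib_right)
  also have "\<dots> = (\<Sum>w\<in>S. zero_mult f w * (ln r - ln (norm w))
    - (if norm (w - 1) \<le> r then \<mu> w * (ln r - ln (m w)) else 0))"
    using S(3) by (intro sum.cong) (auto simp: I_def m_def)
  finally show ?thesis unfolding \<mu>_def m_def .
qed

section \<open>Relatively shifting prime functions\<close>

text \<open>Such a chain would put linearly many zeros into discs, against the bound of order
  \<open>R powr s\<close> with \<open>s < 1\<close>. The lemma guarantees finite length of zeros,
  and it stops the propagation of zeros when the Casoratian vanishes.\<close>

lemma no_infinite_zero_chain: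
  assumes "entire f" "f \<noteq> (\<lambda>_. 0)" "growth_le f s" "0 < s" "s < 1"
  shows "\<exists>j. f (w + of_nat j) \<noteq> 0"
proof (rule ccontr)
  assume "\<not> ?thesis"
  then have zero: "f (w + of_nat j) = 0" for j by blast
  obtain C where C: "C \<ge> 0" "\<And>R. R \<ge> 1 \<Longrightarrow> real (zero_count f R) \<le> C * R powr s"
    using zero_count_bound[OF assms(1-4)] by blast
  have "1 \<le> C * ((norm w + real m + 1) powr s / (real m + 1))" for m :: nat
  proof -
    define R where "R = norm w + real m + 1"
    let ?Z = "{v. norm v \<le> R \<and> f v = 0}"
    have "(\<lambda>j. w + of_nat j) ` {..m} \<subseteq> ?Z"
    proof
      fix v assume "v \<in> (\<lambda>j. w + of_nat j) ` {..m}"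
      then obtain j where j: "j \<le> m" "v = w + of_nat j" by auto
      then have "norm v \<le> norm w + real j" using norm_triangle_ineq[of w "of_nat j"] by simp
      then show "v \<in> ?Z" using j zero by (simp add: R_def)
    qed
    then have "card ((\<lambda>j. w + of_nat j) ` {..m}) \<le> card ?Z"
      by (intro card_mono entire_finite_zeros assms)
    then have "m + 1 \<le> card ?Z"
      by (subst (asm) card_image) (auto simp: inj_on_def)
    also have "\<dots> \<le> zero_count f R"
    proof -
      have "(\<Sum>v\<in>?Z. 1) \<le> zero_count f R"
        unfolding zero_count_def
        using zero_mult_pos_iff[OF assms(1,2)] by (intro sum_mono) (auto simp: Suc_le_eq)
      then show ?thesis by simp
    qed
    finally have "real m + 1 \<le> C * R powr s"
      using C(2)[of R] by (simp add: R_def)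
    then show ?thesis by (simp add: R_def field_simps)
  qed
  moreover have "(\<lambda>m::nat. C * ((norm w + real m + 1) powr s / (real m + 1))) \<longlonglongrightarrow> C * 0"
    by (intro tendsto_mult_left) (use assms(4,5) in real_asymp)
  ultimately have "1 \<le> C * 0" by (intro LIMSEQ_le_const) auto
  then show False by simp
qed

text \<open>As in Newton's forward formula, the differences at \<open>w\<close> determine the values
  to its right; the induction handles all orders \<open>k\<close> at once.\<close>

lemma fdiff_iterates_zero:
  assumes "\<And>k. (fdiff ^^ k) f w = 0"
  shows "f (w + of_nat j) = 0"
proof -
  have "(fdiff ^^ k) f (w + of_nat j) = 0" for k
  proof (induction j arbitrary: k)
    case (Suc j)
    have "(fdiff ^^ Suc k) f (w + of_nat j)
        = (fdiff ^^ k) f (w + of_nat j + 1) - (fdiff ^^ k) f (w + of_nat j)"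
      by (simp add: fdiff_def)
    then show ?case using Suc[of k] Suc[of "Suc k"] by (simp add: add_ac)
  qed (use assms in simp)
  from this[of 0] show ?thesis by simp
qed

lemma zero_of_length_exists:
  assumes "f w = 0" "f (w + of_nat j) \<noteq> 0"
  shows "\<exists>n. zero_of_length f w n"
proof -
  have ex: "\<exists>k. (fdiff ^^ k) f w \<noteq> 0"
    using fdiff_iterates_zero[of f w j] assms(2) by blast
  define n where "n = (LEAST k. (fdiff ^^ k) f w \<noteq> 0)"
  have n: "(fdiff ^^ n) f w \<noteq> 0" unfolding n_def by (rule LeastI_ex[OF ex])
  moreover have "(fdiff ^^ k) f w = 0" if "k < n" for k
    using not_less_Least[of k "\<lambda>k. (fdiff ^^ k) f w \<noteq> 0"] that by (simp add: n_def)
  moreover have "n \<noteq> 0" using n assms(1) by (intro notI) simp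
  ultimately show ?thesis unfolding zero_of_length_def by (intro exI[of _ n]) auto
qed

lemma entire_linear_factor:
  assumes "entire f" "f \<noteq> (\<lambda>_. 0)" "f w = 0"
  obtains F where "entire F" "\<And>z. f z = (z - w) * F z"
proof -
  obtain g where g: "entire g" "\<And>z. f z = (z - w) ^ zero_mult f w * g z"
    using zero_mult_factor[OF assms(1,2)] by blast
  obtain n where n: "zero_mult f w = Suc n"
    using zero_mult_pos_iff[OF assms(1,2), of w] assms(3) gr0_implies_Suc by blast
  show ?thesis
  proof (rule that)
    show "entire (\<lambda>z. (z - w) ^ n * g z)"
      using g(1) unfolding entire_def by (intro holomorphic_intros)
    show "f z = (z - w) * ((z - w) ^ n * g z)" for z
      using g(2)[of z] by (simp add: n)
  qed
qed

text \<open>For \<open>m1 = n1 = 1\<close> the product \<open>(z - w) * (z - (w + 1))\<close> is the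
  falling factorial of \<open>z - w\<close> of degree 2, so adjacent zeros give a common shifting
  divisor at \<open>w\<close>. The \<open>chain\<close> hypotheses supply the lengths that the
  definition asks for.\<close>

lemma relatively_shifting_prime_no_adjacent_zeros:
  assumes "entire f" "f \<noteq> (\<lambda>_. 0)" "entire g" "g \<noteq> (\<lambda>_. 0)"
    and chain: "\<And>w. \<exists>j. f (w + of_nat j) \<noteq> 0" "\<And>w. \<exists>j. g (w + of_nat j) \<noteq> 0"
    and prime: "relatively_shifting_prime f g"
  shows "f w = 0 \<Longrightarrow> g (w + 1) \<noteq> 0" and "g w = 0 \<Longrightarrow> f (w + 1) \<noteq> 0"
proof -
  have ffall: "ffall x (Suc 0) = x" "ffall x (Suc (Suc 0)) = x * (x - 1)" for x
    by (auto simp: ffall_def)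
  show "g (w + 1) \<noteq> 0" if f0: "f w = 0"
  proof
    assume g0: "g (w + 1) = 0"
    obtain F where F: "entire F" "\<And>z. f z = (z - w) * F z"
      using entire_linear_factor[OF assms(1,2) f0] by blast
    obtain G where G: "entire G" "\<And>z. g z = (z - (w + 1)) * G z"
      using entire_linear_factor[OF assms(3,4) g0] by blast
    obtain m n where mn: "zero_of_length f w m" "zero_of_length g (w + 1) n"
      using zero_of_length_exists f0 g0 chain by meson
    have "common_shifting_divisor f g w"
      unfolding common_shifting_divisor_def
      by (rule exI[of _ w], rule exI[of _ "w + 1"], rule exI[of _ m], rule exI[of _ n],
          rule exI[of _ 1], rule exI[of _ 1], rule exI[of _ F], rule exI[of _ G])
        (use mn F(1) G(1) in \<open>auto simp: F(2) G(2) ffall zero_of_length_def algebra_simps\<close>)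
    then show False using prime by (auto simp: relatively_shifting_prime_def)
  qed
  show "f (w + 1) \<noteq> 0" if g0: "g w = 0"
  proof
    assume f0: "f (w + 1) = 0"
    obtain F where F: "entire F" "\<And>z. f z = (z - (w + 1)) * F z"
      using entire_linear_factor[OF assms(1,2) f0] by blast
    obtain G where G: "entire G" "\<And>z. g z = (z - w) * G z"
      using entire_linear_factor[OF assms(3,4) g0] by blast
    obtain m n where mn: "zero_of_length f (w + 1) m" "zero_of_length g w n"
      using zero_of_length_exists f0 g0 chain by meson
    have "common_shifting_divisor f g w"
      unfolding common_shifting_divisor_def
      by (rule exI[of _ "w + 1"], rule exI[of _ w], rule exI[of _ m], rule exI[of _ n],
          rule exI[of _ 1], rule exI[of _ 1], rule exI[of _ F], rule exI[of _ G])
        (use mn F(1) G(1) in \<open>auto simp: F(2) G(2) ffall zero_of_length_def algebra_simps\<close>)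
    then show False using prime by (auto simp: relatively_shifting_prime_def)
  qed
qed

section \<open>The Casoratian estimate\<close>

lemma circle_integrable:
  assumes "continuous_on (sphere 0 r) u" "r \<ge> 0"
  shows "(\<lambda>\<theta>. u (of_real r * cis \<theta>) :: real) integrable_on {0..2 * pi}"
proof (rule integrable_continuous_interval)
  show "continuous_on {0..2 * pi} (\<lambda>\<theta>. u (of_real r * cis \<theta>))"
    by (rule continuous_on_compose2[OF assms(1)])
      (use assms(2) in \<open>auto intro!: continuous_intros simp: norm_mult\<close>)
qed

lemma circle_mean_mono:
  assumes "continuous_on (sphere 0 r) u" "continuous_on (sphere 0 r) v" "r \<ge> 0"
    "\<And>z. norm z = r \<Longrightarrow> u z \<le> v z"
  shows "circle_mean u r \<le> circle_mean v r"
  unfolding circle_mean_def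
  by (intro mult_left_mono integral_le circle_integrable assms)
    (use assms(3) in \<open>auto simp: norm_mult\<close>)

lemma circle_mean_add:
  assumes "continuous_on (sphere 0 r) u" "continuous_on (sphere 0 r) v" "r \<ge> 0"
  shows "circle_mean (\<lambda>z. u z + v z) r = circle_mean u r + circle_mean v r"
  unfolding circle_mean_def
  using circle_integrable[OF assms(1,3)] circle_integrable[OF assms(2,3)]
  by (simp add: integral_add distrib_left)

lemma circle_mean_add_const:
  assumes "continuous_on (sphere 0 r) u" "r \<ge> 0"
  shows "circle_mean (\<lambda>z. u z + C) r = circle_mean u r + C"
  using circle_mean_add[OF assms(1) _ assms(2), of "\<lambda>_. C"]
  by (simp add: circle_mean_def)

lemma circle_mean_cong:
  assumes "\<And>z. norm z = r \<Longrightarrow> u z = v z" "r \<ge> 0"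
  shows "circle_mean u r = circle_mean v r"
proof -
  have "u (of_real r * cis \<theta>) = v (of_real r * cis \<theta>)" for \<theta>
    using assms by (simp add: norm_mult)
  then show ?thesis by (simp add: circle_mean_def)
qed

text \<open>The normalizing term does not involve \<open>r\<close> and can be read off at
  \<open>r = 0\<close>, which avoids the case distinction on \<open>max_norm fs 0\<close>.\<close>

lemma T_tilde_eq_circle_mean:
  obtains K where "\<And>r. T_tilde fs r = circle_mean (\<lambda>z. ln (max_norm fs z)) r + K"
proof (rule that)
  show "T_tilde fs r = circle_mean (\<lambda>z. ln (max_norm fs z)) r
    + (T_tilde fs 0 - circle_mean (\<lambda>z. ln (max_norm fs z)) 0)" for r
    unfolding T_tilde_def circle_mean_def by linarith
qed

lemma max_norm_triple: "max_norm [a, b, c] z = max (norm (a z)) (max (norm (b z)) (norm (c z)))"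
  by (simp add: max_norm_def max.commute max.left_commute)

section \<open>Adjacent zeros of a triple and of its product\<close>

definition no_adjacent_zeros :: "(complex \<Rightarrow> complex) \<Rightarrow> (complex \<Rightarrow> complex) \<Rightarrow> bool" where
  "no_adjacent_zeros f g \<longleftrightarrow> (\<forall>w. (f w = 0 \<longrightarrow> g (w + 1) \<noteq> 0) \<and> (g w = 0 \<longrightarrow> f (w + 1) \<noteq> 0))"

lemma no_adjacent_zeros_mult:
  assumes "entire f" "entire g" "no_adjacent_zeros f g"
  shows "zero_mult f w = 0 \<or> zero_mult g (w - 1) = 0"
    and "zero_mult g w = 0 \<or> zero_mult f (w - 1) = 0"
proof -
  show "zero_mult f w = 0 \<or> zero_mult g (w - 1) = 0"
    using assms zero_mult_eq_0[of f w] zero_mult_eq_0[of g "w - 1"]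
    by (auto simp: no_adjacent_zeros_def) (metis diff_add_cancel)
  show "zero_mult g w = 0 \<or> zero_mult f (w - 1) = 0"
    using assms zero_mult_eq_0[of g w] zero_mult_eq_0[of f "w - 1"]
    by (auto simp: no_adjacent_zeros_def) (metis diff_add_cancel)
qed

text \<open>Unprimed numbers stand for the multiplicities of the three functions at
  \<open>w\<close>, primed ones for those at \<open>w - 1\<close>. Two positive unprimed numbers
  force all primed ones to be 0, so at most one of the three minima is positive.\<close>

lemma min_add_disjoint:
  fixes x y z :: nat
  assumes "x = 0 \<or> y' = 0" "x = 0 \<or> z' = 0" "y = 0 \<or> x' = 0" "y = 0 \<or> z' = 0"
    "z = 0 \<or> x' = 0" "z = 0 \<or> y' = 0"
  shows "min (x + y + z) (x' + y' + z') = min x x' + min y y' + min z z'"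
    and "min (x + y + z) (x' + y' + z') \<in> {min x x', min y y', min z z'}"
  using assms by auto

context
  fixes a b c :: "complex \<Rightarrow> complex"
  assumes entire: "entire a" "entire b" "entire c"
    and nonzero: "a \<noteq> (\<lambda>_. 0)" "b \<noteq> (\<lambda>_. 0)" "c \<noteq> (\<lambda>_. 0)"
    and nonadj: "no_adjacent_zeros a b" "no_adjacent_zeros a c" "no_adjacent_zeros b c"
begin

lemma triple_entire: "entire (\<lambda>z. a z * b z * c z)"
  by (intro entire_mult entire)

lemma triple_nonzero: "(\<lambda>z. a z * b z * c z) \<noteq> (\<lambda>_. 0)"
  by (intro entire_mult_nonzero entire_mult entire nonzero)

lemma triple_zero_mult:
  "zero_mult (\<lambda>z. a z * b z * c z) w = zero_mult a w + zero_mult b w + zero_mult c w"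
  using zero_mult_mult[OF entire_mult[OF entire(1,2)] entire(3)
      entire_mult_nonzero[OF entire(1,2) nonzero(1,2)] nonzero(3)]
    zero_mult_mult[OF entire(1,2) nonzero(1,2)] by simp

lemma triple_min_zero_mult:
  defines "\<mu> \<equiv> \<lambda>f w. min (zero_mult f w) (zero_mult f (w - 1))"
  shows "\<mu> (\<lambda>z. a z * b z * c z) w = \<mu> a w + \<mu> b w + \<mu> c w"
    and "\<mu> (\<lambda>z. a z * b z * c z) w \<in> {\<mu> a w, \<mu> b w, \<mu> c w}"
  unfolding \<mu>_def triple_zero_mult
  by (intro min_add_disjoint no_adjacent_zeros_mult entire nonadj)+

lemma Nbar_delta_triple:
  assumes "r > 0"
  shows "Nbar_delta (\<lambda>z. a z * b z * c z) r = Nbar_delta a r + Nbar_delta b r + Nbar_delta c r"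
proof -
  define S where "S = {w. norm w \<le> r \<and> a w * b w * c w = 0}"
  have S: "finite S" "\<And>w. w \<in> S \<Longrightarrow> norm w \<le> r"
    using entire_finite_zeros[OF triple_entire triple_nonzero] by (auto simp: S_def)
  have Nbar: "Nbar_delta f r = (\<Sum>w\<in>S. zero_mult f w * (ln r - ln (norm w))
    - (if norm (w - 1) \<le> r
       then min (zero_mult f w) (zero_mult f (w - 1)) * (ln r - ln (max (norm w) (norm (w - 1))))
       else 0))"
    if "entire f" "f \<noteq> (\<lambda>_. 0)" "\<And>w. f w = 0 \<Longrightarrow> a w * b w * c w = 0" for f
    by (rule Nbar_delta_eq_sum[OF that(1,2) assms S(1) _ S(2)]) (auto simp: S_def dest: that(3))
  have mult: "real (zero_mult (\<lambda>z. a z * b z * c z) w)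
      = real (zero_mult a w) + real (zero_mult b w) + real (zero_mult c w)" for w
    unfolding triple_zero_mult by simp
  have min_mult: "real (min (zero_mult (\<lambda>z. a z * b z * c z) w) (zero_mult (\<lambda>z. a z * b z * c z) (w - 1)))
      = real (min (zero_mult a w) (zero_mult a (w - 1))) + real (min (zero_mult b w) (zero_mult b (w - 1)))
        + real (min (zero_mult c w) (zero_mult c (w - 1)))" for w
    unfolding triple_min_zero_mult(1) by (simp only: of_nat_add)
  note Nbar_a = Nbar[OF entire(1) nonzero(1)]
    and Nbar_b = Nbar[OF entire(2) nonzero(2)]
    and Nbar_c = Nbar[OF entire(3) nonzero(3)]
  have "Nbar_delta (\<lambda>z. a z * b z * c z) r = (\<Sum>w\<in>S. zero_mult (\<lambda>z. a z * b z * c z) w * (ln r - ln (norm w))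
    - (if norm (w - 1) \<le> r
       then min (zero_mult (\<lambda>z. a z * b z * c z) w) (zero_mult (\<lambda>z. a z * b z * c z) (w - 1))
         * (ln r - ln (max (norm w) (norm (w - 1)))) else 0))"
    by (rule Nbar[OF triple_entire triple_nonzero])
  also have "\<dots> = Nbar_delta a r + Nbar_delta b r + Nbar_delta c r"
    unfolding mult min_mult
    by (subst Nbar_a, simp, subst Nbar_b, simp, subst Nbar_c, simp, unfold sum.distrib[symmetric],
        intro sum.cong refl) (simp add: algebra_simps del: of_nat_min)
  finally show ?thesis .
qed

end

text \<open>The coefficients are left open so that one statement serves the expansions of
  \<open>W\<close> along \<open>a\<close>, \<open>b\<close> and \<open>c\<close>. Both summands
  contain a power of \<open>z - v\<close>: the shift of \<open>f\<close> vanishes at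
  \<open>v\<close> as \<open>f\<close> does at \<open>v + 1\<close>.\<close>

lemma zero_mult_casoratian:
  assumes "entire f" "f \<noteq> (\<lambda>_. 0)" "entire g1" "entire g2"
    and W: "\<And>z. W z = f z * g1 z + f (z + 1) * g2 z" "W \<noteq> (\<lambda>_. 0)"
  shows "min (zero_mult f v) (zero_mult f (v + 1)) \<le> zero_mult W v"
proof -
  obtain F where F: "entire F" "\<And>z. f z = (z - v) ^ zero_mult f v * F z"
    using zero_mult_factor[OF assms(1,2)] by blast
  obtain G where G: "entire G" "\<And>z. f z = (z - (v + 1)) ^ zero_mult f (v + 1) * G z"
    using zero_mult_factor[OF assms(1,2)] by blast
  define n where "n = min (zero_mult f v) (zero_mult f (v + 1))"
  define i j where "i = zero_mult f v - n" and "j = zero_mult f (v + 1) - n"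
  then have ij: "zero_mult f v = n + i" "zero_mult f (v + 1) = n + j"
    by (simp_all add: n_def)
  have lin: "entire (\<lambda>z. (z - v) ^ k)" for k
    unfolding entire_def by (intro holomorphic_intros)
  have G1: "f (z + 1) = (z - v) ^ (n + j) * G (z + 1)" for z
    using G(2)[of "z + 1"] by (simp add: ij)
  have eq: "W z = (z - v) ^ n * ((z - v) ^ i * F z * g1 z + (z - v) ^ j * G (z + 1) * g2 z)" for z
    unfolding W(1) G1 by (subst F(2)) (simp add: ij power_add algebra_simps)
  have "entire (\<lambda>z. (z - v) ^ i * F z * g1 z + (z - v) ^ j * G (z + 1) * g2 z)"
    using entire_mult[OF entire_mult[OF lin F(1)] assms(3)]
      entire_mult[OF entire_mult[OF lin entire_shift[OF G(1), of 1]] assms(4)]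
    unfolding entire_def by (intro holomorphic_on_add)
  moreover have "entire W"
    unfolding W(1)[abs_def]
    using entire_mult[OF assms(1,3)] entire_mult[OF entire_shift[OF assms(1), of 1] assms(4)]
    unfolding entire_def by (intro holomorphic_on_add)
  ultimately show ?thesis
    using zero_mult_geI[OF _ W(2) _ eq] by (simp add: n_def)
qed

text \<open>The discount for a pair \<open>w\<close>, \<open>w - 1\<close> is charged to the zero
  \<open>w - 1\<close> of \<open>W\<close>, injectively in \<open>w\<close>. Its weight is taken at
  the larger modulus and is thus at most the weight of that zero in
  \<open>Nzeros W r\<close>.\<close>

lemma Nbar_delta_ge_Nzeros_diff:
  assumes P: "entire P" "P \<noteq> (\<lambda>_. 0)" and W: "entire W" "W \<noteq> (\<lambda>_. 0)" and r: "r \<ge> 1"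
    and le: "\<And>w. min (zero_mult P w) (zero_mult P (w - 1)) \<le> zero_mult W (w - 1)"
  shows "Nzeros P r - Nzeros W r \<le> Nbar_delta P r"
proof -
  define \<mu> where "\<mu> w = min (zero_mult P w) (zero_mult P (w - 1))" for w
  define S where "S = {w. norm w \<le> r \<and> P w = 0}"
  have S: "finite S" using entire_finite_zeros[OF P] by (simp add: S_def)
  define D where "D w = \<mu> w * (ln r - ln (max (norm w) (norm (w - 1))))" for w
  define L where "L w = zero_mult W w * (ln r - ln (norm w))" for w
  define S' where "S' = {w \<in> S. norm (w - 1) \<le> r \<and> \<mu> w > 0}"
  \<comment> \<open>By \<open>ln 0 = 0\<close> a zero at the origin has weight \<open>ln r\<close>,
    whose sign is where \<open>r \<ge> 1\<close> enters.\<close>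
  have L0: "L v \<ge> 0" if "norm v \<le> r" for v
    using that r by (cases "v = 0") (auto simp: L_def intro!: mult_nonneg_nonneg)
  have "(\<Sum>w\<in>S. if norm (w - 1) \<le> r then D w else 0) = (\<Sum>w\<in>S'. D w)"
    using S by (intro sum.mono_neutral_cong_right) (auto simp: S'_def D_def)
  also have "\<dots> \<le> (\<Sum>w\<in>S'. L (w - 1))"
  proof (rule sum_mono)
    fix w assume w: "w \<in> S'"
    \<comment> \<open>For \<open>w = 1\<close> both sides are 0, the left one because
      \<open>ln 0 = 0\<close>.\<close>
    have "ln (norm (w - 1)) \<le> ln (max (norm w) (norm (w - 1)))"
    proof (cases "w = 1")
      case False
      have "max (norm w) (norm (w - 1)) \<ge> norm (w - 1)" "norm (w - 1) > 0" using False by auto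
      then show ?thesis by (subst ln_le_cancel_iff) linarith+
    qed auto
    moreover have "ln (max (norm w) (norm (w - 1))) \<le> ln r"
      using w max_norm_shift_ge_half[of w] by (subst ln_le_cancel_iff) (auto simp: S'_def S_def)
    ultimately show "D w \<le> L (w - 1)"
      unfolding D_def L_def using le[of w] by (intro mult_mono) (auto simp: \<mu>_def)
  qed
  also have "\<dots> = (\<Sum>v\<in>(\<lambda>w. w - 1) ` S'. L v)"
    by (subst sum.reindex) (auto simp: inj_on_def)
  also have "\<dots> \<le> Nzeros W r"
    unfolding Nzeros_def L_def[symmetric]
  proof (rule sum_mono2)
    show "finite {w. norm w \<le> r \<and> W w = 0}" by (rule entire_finite_zeros[OF W])
    show "(\<lambda>w. w - 1) ` S' \<subseteq> {w. norm w \<le> r \<and> W w = 0}"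
    proof
      fix v assume "v \<in> (\<lambda>w. w - 1) ` S'"
      then obtain w where w: "w \<in> S'" "v = w - 1" by auto
      then have "zero_mult W v > 0" using le[of w] by (auto simp: S'_def \<mu>_def)
      then show "v \<in> {w. norm w \<le> r \<and> W w = 0}"
        using w zero_mult_pos_iff[OF W] by (auto simp: S'_def)
    qed
    show "0 \<le> L v" if "v \<in> {w. norm w \<le> r \<and> W w = 0} - (\<lambda>w. w - 1) ` S'" for v
      using that by (intro L0) auto
  qed
  finally have D_le: "(\<Sum>w\<in>S. if norm (w - 1) \<le> r then D w else 0) \<le> Nzeros W r" .
  have "Nbar_delta P r = (\<Sum>w\<in>S. zero_mult P w * (ln r - ln (norm w))
      - (if norm (w - 1) \<le> r then D w else 0))"
    unfolding D_def \<mu>_def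
    by (rule Nbar_delta_eq_sum[OF P _ S]) (use r in \<open>auto simp: S_def\<close>)
  also have "\<dots> = Nzeros P r - (\<Sum>w\<in>S. if norm (w - 1) \<le> r then D w else 0)"
    by (simp add: sum_subtractf Nzeros_def S_def)
  finally show ?thesis using D_le by simp
qed

text \<open>Both quotients are limits of the same zero products; below order 1 there is no room for
  an exponential factor.\<close>

lemma proportional_if_same_zeros:
  assumes f: "entire f" "f \<noteq> (\<lambda>_. 0)" "growth_le f s" and g: "entire g" "g \<noteq> (\<lambda>_. 0)" "growth_le g s"
    and s: "0 < s" "s < 1" and same: "\<And>w. zero_mult f w = zero_mult g w"
  obtains k where "\<And>z. f z = k * g z"
proof -
  have zeros: "f w = 0 \<longleftrightarrow> g w = 0" for w
    using zero_mult_pos_iff[OF f(1,2), of w] zero_mult_pos_iff[OF g(1,2), of w] same[of w] by simp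
  obtain z where z: "f z \<noteq> 0" "g z \<noteq> 0" using f(2) zeros by auto
  have "f u = f z / g z * g u" for u
  proof -
    have "f u / f z = g u / g z"
      using quotient_as_limit_of_zero_products[OF f s z(1), of u]
        quotient_as_limit_of_zero_products[OF g s z(2), of u]
      by (intro LIMSEQ_unique[of _ "f u / f z" "g u / g z"]) (simp_all add: same zeros)
    then show ?thesis using z by (simp add: field_simps)
  qed
  then show ?thesis by (rule that)
qed

text \<open>If \<open>f\<close> vanishes at \<open>w\<close> and \<open>g\<close> does not,
  \<open>eq\<close> makes \<open>f\<close> vanish at \<open>w + 1\<close>, and \<open>nonadj\<close>
  keeps \<open>g\<close> nonzero there; this repeats forever, against \<open>chain\<close>. So the
  zeros coincide and are not adjacent, and \<open>eq\<close> compares multiplicities because the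
  shifted factors do not vanish.\<close>

lemma casoratian_zero_imp_same_zeros:
  assumes f: "entire f" "f \<noteq> (\<lambda>_. 0)" and g: "entire g" "g \<noteq> (\<lambda>_. 0)"
    and chain: "\<And>w. \<exists>j. f (w + of_nat j) \<noteq> 0" "\<And>w. \<exists>j. g (w + of_nat j) \<noteq> 0"
    and nonadj: "no_adjacent_zeros f g"
    and eq: "\<And>z. f z * g (z + 1) = f (z + 1) * g z"
  shows "zero_mult f w = zero_mult g w" and "f w = 0 \<Longrightarrow> f (w + 1) \<noteq> 0"
proof -
  have transfer: "g w = 0"
    if "f w = 0" "\<And>w. \<exists>j. f (w + of_nat j) \<noteq> 0" "no_adjacent_zeros f g"
      "\<And>z. f z * g (z + 1) = f (z + 1) * g z"
    for f g :: "complex \<Rightarrow> complex" and w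
  proof (rule ccontr)
    assume "g w \<noteq> 0"
    have "f (w + of_nat j) = 0 \<and> g (w + of_nat j) \<noteq> 0" for j
    proof (induction j)
      case (Suc j)
      have "f (w + of_nat j + 1) * g (w + of_nat j) = 0"
        using that(4)[of "w + of_nat j"] Suc by simp
      then show ?case
        using Suc that(3) by (auto simp: no_adjacent_zeros_def add_ac)
    qed (use that(1) \<open>g w \<noteq> 0\<close> in simp)
    then show False using that(2) by blast
  qed
  have zeros: "f w = 0 \<longleftrightarrow> g w = 0" for w
    using transfer[of f w g] transfer[of g w f] chain nonadj eq
    by (auto simp: no_adjacent_zeros_def mult.commute)
  show simple: "f (w + 1) \<noteq> 0" if "f w = 0" for w
    using that zeros nonadj by (auto simp: no_adjacent_zeros_def)
  show "zero_mult f w = zero_mult g w"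
  proof (cases "f w = 0")
    case True
    have nz: "f (w + 1) \<noteq> 0" "g (w + 1) \<noteq> 0" using simple[OF True] zeros by auto
    have shift: "entire (\<lambda>z. f (z + 1))" "entire (\<lambda>z. g (z + 1))"
      by (intro entire_shift f g)+
    have ne: "(\<lambda>z. f (z + 1)) \<noteq> (\<lambda>_. 0)" "(\<lambda>z. g (z + 1)) \<noteq> (\<lambda>_. 0)"
      using nz by metis+
    have "zero_mult f w = zero_mult (\<lambda>z. f z * g (z + 1)) w"
      using zero_mult_mult[OF f(1) shift(2) f(2) ne(2)] zero_mult_eq_0[OF shift(2)] nz by simp
    also have "\<dots> = zero_mult (\<lambda>z. f (z + 1) * g z) w" by (simp add: eq)
    also have "\<dots> = zero_mult g w"
      using zero_mult_mult[OF shift(1) g(1) ne(1) g(2)] zero_mult_eq_0[OF shift(1)] nz by simp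
    finally show ?thesis .
  next
    case False
    then show ?thesis using zeros zero_mult_eq_0 f g by metis
  qed
qed

text \<open>Each bound on \<open>W\<close> lacks one of the three factors; multiplying by the
  missing one gives the same right-hand side.\<close>

lemma mult_max_le:
  fixes W A B C \<kappa> :: real
  assumes "W \<le> A * B * \<kappa>" "W \<le> A * C * \<kappa>" "W \<le> C * B * \<kappa>" "A \<ge> 0" "B \<ge> 0" "C \<ge> 0"
  shows "W * max A (max B C) \<le> \<kappa> * (A * B * C)"
proof -
  have "W * A \<le> C * B * \<kappa> * A" "W * B \<le> A * C * \<kappa> * B" "W * C \<le> A * B * \<kappa> * C"
    using assms by (intro mult_right_mono; simp)+
  then show ?thesis by (auto simp: max_def mult_ac)
qed

lemma continuous_on_ln_norm:
  assumes "entire f" "\<And>z. norm z = r \<Longrightarrow> f z \<noteq> 0"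
  shows "continuous_on (sphere 0 r) (\<lambda>z. ln (norm (f z)))"
  using assms by (intro continuous_intros entire_continuous_on) auto

lemma continuous_on_ln_max_norm:
  assumes "entire a" "entire b" "entire c" "\<And>z. norm z = r \<Longrightarrow> a z \<noteq> 0"
  shows "continuous_on (sphere 0 r) (\<lambda>z. ln (max_norm [a, b, c] z))"
  unfolding max_norm_triple
proof (intro continuous_intros entire_continuous_on assms ballI)
  fix z :: complex assume "z \<in> sphere 0 r"
  then have "norm (a z) > 0" using assms(4) by simp
  then show "max (norm (a z)) (max (norm (b z)) (norm (c z))) \<noteq> 0" by linarith
qed

lemma T_tilde_bound_casoratian:
  assumes entire: "entire a" "entire b" "entire c"
    and nonzero: "a \<noteq> (\<lambda>_. 0)" "b \<noteq> (\<lambda>_. 0)" "c \<noteq> (\<lambda>_. 0)"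
    and nonadj: "no_adjacent_zeros a b" "no_adjacent_zeros a c" "no_adjacent_zeros b c"
    and growth: "growth_le a s" "growth_le b s" "growth_le c s"
    and st: "0 < s" "s < t" "t < 1"
    and sum: "\<And>z. c z = a z + b z"
    and W: "W = (\<lambda>z. a z * b (z + 1) - a (z + 1) * b z)" "W \<noteq> (\<lambda>_. 0)"
  obtains E K where "finite_log_measure E"
    "\<And>r. r \<ge> 1 \<Longrightarrow> r \<notin> E \<Longrightarrow>
      T_tilde [a, b, c] r \<le> Nbar_delta (\<lambda>z. a z * b z * c z) r + (t - 1) * ln r + K"
proof -
  define P where "P = (\<lambda>z. a z * b z * c z)"
  have P: "entire P" "P \<noteq> (\<lambda>_. 0)"
    unfolding P_def by (rule triple_entire[OF entire nonzero nonadj] triple_nonzero[OF entire nonzero nonadj])+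
  have eW: "entire W"
    unfolding W(1) by (intro entire_diff entire_mult entire_shift entire)
  obtain Ea where Ea: "finite_log_measure Ea"
    "\<And>z. norm z \<ge> 1 \<Longrightarrow> norm z \<notin> Ea \<Longrightarrow> a z \<noteq> 0"
    "\<And>z. norm z \<ge> 1 \<Longrightarrow> norm z \<notin> Ea \<Longrightarrow> norm (a (z + 1) / a z - 1) \<le> 2 * norm z powr (t - 1)"
    using shift_quotient_bound[OF entire(1) nonzero(1) growth(1) st] by blast
  obtain Eb where Eb: "finite_log_measure Eb"
    "\<And>z. norm z \<ge> 1 \<Longrightarrow> norm z \<notin> Eb \<Longrightarrow> b z \<noteq> 0"
    "\<And>z. norm z \<ge> 1 \<Longrightarrow> norm z \<notin> Eb \<Longrightarrow> norm (b (z + 1) / b z - 1) \<le> 2 * norm z powr (t - 1)"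
    using shift_quotient_bound[OF entire(2) nonzero(2) growth(2) st] by blast
  obtain Ec where Ec: "finite_log_measure Ec"
    "\<And>z. norm z \<ge> 1 \<Longrightarrow> norm z \<notin> Ec \<Longrightarrow> c z \<noteq> 0"
    "\<And>z. norm z \<ge> 1 \<Longrightarrow> norm z \<notin> Ec \<Longrightarrow> norm (c (z + 1) / c z - 1) \<le> 2 * norm z powr (t - 1)"
    using shift_quotient_bound[OF entire(3) nonzero(3) growth(3) st] by blast
  \<comment> \<open>Off these radii Jensen's formula and the continuity of the logarithm are
    available for \<open>W\<close>.\<close>
  define EW where "EW = norm ` {z. W z = 0} \<inter> {1..}"
  have "finite_log_measure EW"
    unfolding EW_def using entire_countable_zeros[OF eW W(2)]
    by (intro finite_log_measure_countable) auto
  then have E: "finite_log_measure (Ea \<union> Eb \<union> Ec \<union> EW)"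
    using Ea(1) Eb(1) Ec(1) by (intro finite_log_measure_Un)
  obtain KP where KP: "\<And>r. r > 0 \<Longrightarrow> (\<And>z. norm z = r \<Longrightarrow> P z \<noteq> 0) \<Longrightarrow>
    circle_mean (\<lambda>z. ln (norm (P z))) r = Nzeros P r + KP"
    using jensen_formula[OF P] by blast
  obtain KW where KW: "\<And>r. r > 0 \<Longrightarrow> (\<And>z. norm z = r \<Longrightarrow> W z \<noteq> 0) \<Longrightarrow>
    circle_mean (\<lambda>z. ln (norm (W z))) r = Nzeros W r + KW"
    using jensen_formula[OF eW W(2)] by blast
  obtain KT where KT: "\<And>r. T_tilde [a, b, c] r = circle_mean (\<lambda>z. ln (max_norm [a, b, c] z)) r + KT"
    using T_tilde_eq_circle_mean by blast
  show ?thesis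
  proof (rule that[OF E, of "ln 4 + KP - KW + KT"])
    fix r :: real assume r: "r \<ge> 1" "r \<notin> Ea \<union> Eb \<union> Ec \<union> EW"
    have nz: "a z \<noteq> 0" "b z \<noteq> 0" "c z \<noteq> 0" "W z \<noteq> 0" "P z \<noteq> 0" if "norm z = r" for z
      using Ea(2)[of z] Eb(2)[of z] Ec(2)[of z] r that by (auto simp: EW_def P_def)
    have le: "ln (max_norm [a, b, c] z) + ln (norm (W z))
        \<le> ln (norm (P z)) + (ln 4 + (t - 1) * ln r)" if z: "norm z = r" for z
    proof -
      \<comment> \<open>Two shift quotients, each within \<open>2 * r powr (t - 1)\<close> of 1,
        differ by at most twice that.\<close>
      define \<kappa> where "\<kappa> = 4 * r powr (t - 1)"
      have \<kappa>: "norm (x - y) \<le> \<kappa>"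
        if "norm (x - 1) \<le> 2 * r powr (t - 1)" "norm (y - 1) \<le> 2 * r powr (t - 1)" for x y :: complex
        using norm_triangle_ineq4[of "x - 1" "y - 1"] that by (simp add: \<kappa>_def)
      note q = Ea(3)[of z] Eb(3)[of z] Ec(3)[of z]
      have bound: "norm (f z * g (z + 1) - f (z + 1) * g z) \<le> norm (f z) * norm (g z) * \<kappa>"
        if "f z \<noteq> 0" "g z \<noteq> 0" "norm (f (z + 1) / f z - 1) \<le> 2 * r powr (t - 1)"
          "norm (g (z + 1) / g z - 1) \<le> 2 * r powr (t - 1)" for f g :: "complex \<Rightarrow> complex"
      proof -
        have "f z * g (z + 1) - f (z + 1) * g z = f z * g z * (g (z + 1) / g z - f (z + 1) / f z)"
          using that(1,2) by (simp add: field_simps)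
        then show ?thesis
          using mult_left_mono[OF \<kappa>[OF that(4,3)], of "norm (f z * g z)"] by (simp add: norm_mult)
      qed
      have "W z = a z * c (z + 1) - a (z + 1) * c z" "W z = c z * b (z + 1) - c (z + 1) * b z"
        by (simp_all add: W(1) sum algebra_simps)
      then have "norm (W z) \<le> norm (a z) * norm (b z) * \<kappa>" "norm (W z) \<le> norm (a z) * norm (c z) * \<kappa>"
          "norm (W z) \<le> norm (c z) * norm (b z) * \<kappa>"
        using bound[of a b] bound[of a c] bound[of c b] nz[OF z] q r z by (auto simp: W(1))
      then have "norm (W z) * max_norm [a, b, c] z \<le> \<kappa> * (norm (a z) * norm (b z) * norm (c z))"
        unfolding max_norm_triple by (rule mult_max_le) auto
      also have "\<dots> = \<kappa> * norm (P z)" by (simp add: P_def norm_mult)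
      finally have le: "norm (W z) * max_norm [a, b, c] z \<le> \<kappa> * norm (P z)" .
      have pos: "max_norm [a, b, c] z > 0" "norm (W z) > 0" "norm (P z) > 0" "\<kappa> > 0"
        using nz[OF z] r by (auto simp: max_norm_triple \<kappa>_def less_max_iff_disj)
      have "ln (norm (W z) * max_norm [a, b, c] z) \<le> ln (\<kappa> * norm (P z))"
        using le pos by (subst ln_le_cancel_iff) auto
      moreover have "ln \<kappa> = ln 4 + (t - 1) * ln r"
        using r by (simp add: \<kappa>_def ln_mult ln_powr)
      ultimately show ?thesis using pos by (simp add: ln_mult)
    qed
    note cont = continuous_on_ln_max_norm[OF entire nz(1)] continuous_on_ln_norm[OF eW nz(4)]
      continuous_on_ln_norm[OF P(1) nz(5)]
    have r0: "r \<ge> 0" "r > 0" using r by auto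
    have "circle_mean (\<lambda>z. ln (max_norm [a, b, c] z)) r + circle_mean (\<lambda>z. ln (norm (W z))) r
        = circle_mean (\<lambda>z. ln (max_norm [a, b, c] z) + ln (norm (W z))) r"
      by (rule circle_mean_add[symmetric, OF cont(1,2) r0(1)])
    also have "\<dots> \<le> circle_mean (\<lambda>z. ln (norm (P z)) + (ln 4 + (t - 1) * ln r)) r"
      by (rule circle_mean_mono[OF continuous_on_add[OF cont(1,2)]
          continuous_on_add[OF cont(3) continuous_on_const] r0(1) le])
    also have "\<dots> = circle_mean (\<lambda>z. ln (norm (P z))) r + (ln 4 + (t - 1) * ln r)"
      by (rule circle_mean_add_const[OF cont(3) r0(1)])
    finally have "circle_mean (\<lambda>z. ln (max_norm [a, b, c] z)) r
      \<le> Nzeros P r - Nzeros W r + (t - 1) * ln r + (ln 4 + KP - KW)"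
      using KP[OF r0(2) nz(5)] KW[OF r0(2) nz(4)] by simp
    moreover have "Nzeros P r - Nzeros W r \<le> Nbar_delta P r"
    proof (rule Nbar_delta_ge_Nzeros_diff[OF P eW W(2) r(1)])
      fix w
      have neg: "entire (\<lambda>z. - f z)" if "entire f" for f
        using that unfolding entire_def by (rule holomorphic_on_minus)
      have le_f: "min (zero_mult f w) (zero_mult f (w - 1)) \<le> zero_mult W (w - 1)"
        if "f \<in> {a, b, c}" for f
      proof -
        have a: "W z = a z * b (z + 1) + a (z + 1) * (- b z)"
          and b: "W z = b z * (- a (z + 1)) + b (z + 1) * a z"
          and c: "W z = c z * (- a (z + 1)) + c (z + 1) * a z" for z
          by (simp_all add: W(1) sum algebra_simps)
        show ?thesis
          using that
            zero_mult_casoratian[OF entire(1) nonzero(1) entire_shift[OF entire(2)] neg[OF entire(2)] a W(2), of "w - 1"]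
            zero_mult_casoratian[OF entire(2) nonzero(2) neg[OF entire_shift[OF entire(1)]] entire(1) b W(2), of "w - 1"]
            zero_mult_casoratian[OF entire(3) nonzero(3) neg[OF entire_shift[OF entire(1)]] entire(1) c W(2), of "w - 1"]
          by (auto simp: min.commute)
      qed
      \<comment> \<open>The minimum for \<open>P\<close> is that of a single function, so no sum of
        minima has to fit below the multiplicity of \<open>W\<close>.\<close>
      show "min (zero_mult P w) (zero_mult P (w - 1)) \<le> zero_mult W (w - 1)"
        using triple_min_zero_mult(2)[OF entire nonzero nonadj, of w] le_f[of a] le_f[of b] le_f[of c]
        unfolding P_def by (auto simp only: insert_iff empty_iff simp_thms)
    qed
    ultimately show "T_tilde [a, b, c] r
        \<le> Nbar_delta (\<lambda>z. a z * b z * c z) r + (t - 1) * ln r + (ln 4 + KP - KW + KT)"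
      unfolding KT[of r] P_def by simp
  qed
qed

text \<open>If the Casoratian vanishes, then \<open>a\<close>, \<open>b\<close>, \<open>c\<close> are proportional. Their common zeros are never
  adjacent, so each of them contributes its full zero counting function to \<open>Nbar_delta\<close>,
  whereas \<open>T_tilde\<close> sees it only once.\<close>

lemma T_tilde_bound_casoratian_zero:
  assumes entire: "entire a" "entire b" "entire c"
    and nonzero: "a \<noteq> (\<lambda>_. 0)" "b \<noteq> (\<lambda>_. 0)" "c \<noteq> (\<lambda>_. 0)"
    and nonadj: "no_adjacent_zeros a b" "no_adjacent_zeros a c" "no_adjacent_zeros b c"
    and growth: "growth_le a s" "growth_le b s" "growth_le c s"
    and st: "0 < s" "s < t" "t < 1"
    and sum: "\<And>z. c z = a z + b z"
    and nonconst: "\<not> (a constant_on UNIV \<and> b constant_on UNIV \<and> c constant_on UNIV)"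
    and W: "\<And>z. a z * b (z + 1) = a (z + 1) * b z"
  obtains E K where "finite_log_measure E"
    "\<And>r. r \<ge> 1 \<Longrightarrow> r \<notin> E \<Longrightarrow>
      T_tilde [a, b, c] r \<le> Nbar_delta (\<lambda>z. a z * b z * c z) r + (t - 1) * ln r + K"
proof -
  have s1: "s < 1" using st by simp
  have chain: "\<exists>j. f (w + of_nat j) \<noteq> 0" if "f \<in> {a, b, c}" for f w
    using that no_infinite_zero_chain[OF entire(1) nonzero(1) growth(1) st(1) s1, of w]
      no_infinite_zero_chain[OF entire(2) nonzero(2) growth(2) st(1) s1, of w]
      no_infinite_zero_chain[OF entire(3) nonzero(3) growth(3) st(1) s1, of w] by auto
  have ab: "zero_mult a w = zero_mult b w" "a w = 0 \<Longrightarrow> a (w + 1) \<noteq> 0" for w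
    using casoratian_zero_imp_same_zeros[OF entire(1) nonzero(1) entire(2) nonzero(2) _ _ nonadj(1) W]
      chain by auto
  have W': "c z * b (z + 1) = c (z + 1) * b z" for z
    using W[of z] by (simp add: sum algebra_simps)
  have nonadj': "no_adjacent_zeros c b" using nonadj(3) by (auto simp: no_adjacent_zeros_def)
  have cb: "zero_mult c w = zero_mult b w" for w
    using casoratian_zero_imp_same_zeros(1)[OF entire(3) nonzero(3) entire(2) nonzero(2) _ _ nonadj' W']
      chain by auto
  obtain k where k: "\<And>z. a z = k * b z"
    using proportional_if_same_zeros[OF entire(1) nonzero(1) growth(1) entire(2) nonzero(2) growth(2)
      st(1) s1 ab(1)] by blast
  have c_eq: "c z = (k + 1) * b z" for z using sum[of z] k[of z] by (simp add: algebra_simps)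
  have b_zero: "b w = 0 \<Longrightarrow> b (w + 1) \<noteq> 0" for w
    using ab(2)[of w] k by auto
  have "\<exists>w. b w = 0"
  proof (rule ccontr)
    assume no_zero: "\<not> (\<exists>w. b w = 0)"
    \<comment> \<open>Without zeros the products are empty, hence equal to 1.\<close>
    have "b u = b 0" for u
    proof -
      have "(\<lambda>N::nat. 1) \<longlonglongrightarrow> b u / b 0"
        using quotient_as_limit_of_zero_products[OF entire(2) nonzero(2) growth(2) st(1) s1, of 0 u]
          no_zero by simp
      then have "1 = b u / b 0" by (simp add: LIMSEQ_const_iff)
      then show ?thesis using no_zero by (simp add: field_simps)
    qed
    then have "a constant_on UNIV" "b constant_on UNIV" "c constant_on UNIV"
      unfolding constant_on_def using k c_eq by metis+
    then show False using nonconst by blast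
  qed
  then obtain w0 where w0: "b w0 = 0" by blast
  obtain KB where KB: "\<And>r. r > 0 \<Longrightarrow> (\<And>z. norm z = r \<Longrightarrow> b z \<noteq> 0) \<Longrightarrow>
    circle_mean (\<lambda>z. ln (norm (b z))) r = Nzeros b r + KB"
    using jensen_formula[OF entire(2) nonzero(2)] by blast
  obtain KT where KT: "\<And>r. T_tilde [a, b, c] r = circle_mean (\<lambda>z. ln (max_norm [a, b, c] z)) r + KT"
    using T_tilde_eq_circle_mean by blast
  define M where "M = max (norm k) (max 1 (norm (k + 1)))"
  have "M > 0" by (simp add: M_def)
  define E where "E = norm ` {z. b z = 0} \<inter> {1..} \<union> {1..norm w0}"
  have "finite_log_measure E"
    unfolding E_def using entire_countable_zeros[OF entire(2) nonzero(2)]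
    by (intro finite_log_measure_Un finite_log_measure_countable finite_log_measure_interval) auto
  then show ?thesis
  \<comment> \<open>After one of the three copies of \<open>Nzeros b r\<close> is matched with
    \<open>T_tilde\<close>, two remain, each at least \<open>ln r - ln (norm w0)\<close>. This
    accounts for \<open>2 * ln (norm w0)\<close> and leaves \<open>(t + 1) * ln r\<close>, which is
    nonnegative.\<close>
  proof (rule that[of _ "KB + ln M + KT + 2 * ln (norm w0)"])
    fix r assume r: "r \<ge> 1" "r \<notin> E"
    then have r0: "r \<ge> 0" "r > 0" "r > norm w0" by (auto simp: E_def)
    have nz: "b z \<noteq> 0" if "norm z = r" for z
      using r that by (auto simp: E_def)
    have "circle_mean (\<lambda>z. ln (max_norm [a, b, c] z)) r = circle_mean (\<lambda>z. ln (norm (b z)) + ln M) r"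
    proof (rule circle_mean_cong[OF _ r0(1)])
      fix z :: complex assume z: "norm z = r"
      have "max_norm [a, b, c] z = norm (b z) * M"
        by (simp add: max_norm_triple M_def k c_eq norm_mult max_mult_distrib_left mult.commute)
      then show "ln (max_norm [a, b, c] z) = ln (norm (b z)) + ln M"
        using nz[OF z] \<open>M > 0\<close> by (simp add: ln_mult)
    qed
    also have "\<dots> = Nzeros b r + KB + ln M"
      using circle_mean_add_const[OF continuous_on_ln_norm[OF entire(2) nz] r0(1)] KB[OF r0(2) nz] by simp
    finally have T: "T_tilde [a, b, c] r = Nzeros b r + (KB + ln M + KT)" by (simp add: KT)
    have Nbar: "Nbar_delta f r = Nzeros b r"
      if f: "entire f" "f \<noteq> (\<lambda>_. 0)" "\<And>w. zero_mult f w = zero_mult b w" for f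
    proof -
      have zeros: "f w = 0 \<longleftrightarrow> b w = 0" for w
        using zero_mult_pos_iff[OF f(1,2), of w] zero_mult_pos_iff[OF entire(2) nonzero(2), of w] f(3)
        by simp
      have disjoint: "min (zero_mult f w) (zero_mult f (w - 1)) = 0" for w
        using b_zero[of "w - 1"] zero_mult_eq_0[OF entire(2), of w] zero_mult_eq_0[OF entire(2), of "w - 1"]
        by (cases "b (w - 1) = 0") (auto simp: f(3))
      have "Nbar_delta f r = (\<Sum>w | norm w \<le> r \<and> f w = 0. zero_mult f w * (ln r - ln (norm w))
          - (if norm (w - 1) \<le> r
             then min (zero_mult f w) (zero_mult f (w - 1))
               * (ln r - ln (max (norm w) (norm (w - 1)))) else 0))"
        by (rule Nbar_delta_eq_sum[OF f(1,2) r0(2) entire_finite_zeros[OF f(1,2)]]) auto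
      also have "\<dots> = Nzeros b r"
        unfolding disjoint by (auto simp: Nzeros_def zeros f(3) intro!: sum.cong)
      finally show ?thesis .
    qed
    have "Nbar_delta (\<lambda>z. a z * b z * c z) r = 3 * Nzeros b r"
      using Nbar_delta_triple[OF entire nonzero nonadj r0(2)] Nbar[OF entire(1) nonzero(1) ab(1)]
        Nbar[OF entire(2) nonzero(2) refl] Nbar[OF entire(3) nonzero(3) cb] by simp
    moreover have "ln r - ln (norm w0) \<le> Nzeros b r"
    proof -
      have term_nonneg: "0 \<le> ln r - ln (norm w)" if "norm w \<le> r" for w :: complex
        using that r by (cases "w = 0") auto
      have "1 * (ln r - ln (norm w0)) \<le> zero_mult b w0 * (ln r - ln (norm w0))"
        using zero_mult_pos_iff[OF entire(2) nonzero(2), of w0] w0 r0 term_nonneg[of w0]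
        by (intro mult_right_mono) auto
      also have "\<dots> \<le> Nzeros b r"
        unfolding Nzeros_def
        by (rule member_le_sum[of w0 _ "\<lambda>w. zero_mult b w * (ln r - ln (norm w))"])
          (use w0 r0 term_nonneg entire_finite_zeros[OF entire(2) nonzero(2)] in auto)
      finally show ?thesis by simp
    qed
    moreover have "0 \<le> (t + 1) * ln r" using st r by simp
    ultimately show "T_tilde [a, b, c] r
        \<le> Nbar_delta (\<lambda>z. a z * b z * c z) r + (t - 1) * ln r + (KB + ln M + KT + 2 * ln (norm w0))"
      unfolding T by (simp add: algebra_simps)
  qed
qed

theorem theorem3p8:
  fixes a b c :: "complex \<Rightarrow> complex" and \<delta> :: real
  assumes "entire a" "entire b" "entire c"
    and "growth_order a < 1" "growth_order b < 1" "growth_order c < 1"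
    and "a \<noteq> (\<lambda>_. 0)" "b \<noteq> (\<lambda>_. 0)" "c \<noteq> (\<lambda>_. 0)"
    and "relatively_shifting_prime3 a b c"
    and "\<forall>z. a z + b z = c z"
    and "\<not> (a constant_on UNIV \<and> b constant_on UNIV \<and> c constant_on UNIV)"
    and "ereal \<delta> = max (growth_order a) (max (growth_order b) (growth_order c))"
  shows "\<exists>R>0. \<forall>\<epsilon>>0. \<exists>E. finite_log_measure E \<and>
           (\<forall>r. r > R \<and> r \<notin> E \<longrightarrow>
              T_tilde [a, b, c] r
                \<le> Nbar_delta (\<lambda>z. a z * b z * c z) r - (1 - \<delta> - \<epsilon>) * ln r \<and>
              Nbar_delta (\<lambda>z. a z * b z * c z) r - (1 - \<delta> - \<epsilon>) * ln r
                = Nbar_delta a r + Nbar_delta b r + Nbar_delta c r - (1 - \<delta> - \<epsilon>) * ln r)"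
proof -
  note entire = assms(1-3) and nonzero = assms(7-9)
  have sum: "c z = a z + b z" for z using assms(11) by simp
  have \<delta>: "\<delta> < 1" "\<delta> \<ge> 0"
  proof -
    have "ereal \<delta> < 1" using assms(4-6,13) by simp
    then show "\<delta> < 1" by simp
    have "0 \<le> ereal \<delta>" using growth_order_nonneg[of a] assms(13) by (simp add: le_max_iff_disj)
    then show "\<delta> \<ge> 0" by simp
  qed
  have growth: "growth_le a s" "growth_le b s" "growth_le c s" if "s > \<delta>" for s
  proof -
    have "max (growth_order a) (max (growth_order b) (growth_order c)) < ereal s"
      using that assms(13)[symmetric] by simp
    then show "growth_le a s" "growth_le b s" "growth_le c s"
      using growth_le_if_growth_order_less entire by auto
  qed
  define s0 where "s0 = (1 + \<delta>) / 2"
  have s0: "\<delta> < s0" "0 < s0" "s0 < 1" using \<delta> by (auto simp: s0_def)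
  note chain = no_infinite_zero_chain[OF entire(1) nonzero(1) growth(1)[OF s0(1)] s0(2,3)]
    no_infinite_zero_chain[OF entire(2) nonzero(2) growth(2)[OF s0(1)] s0(2,3)]
    no_infinite_zero_chain[OF entire(3) nonzero(3) growth(3)[OF s0(1)] s0(2,3)]
  have prime: "relatively_shifting_prime a b" "relatively_shifting_prime a c"
    "relatively_shifting_prime b c"
    using assms(10) by (auto simp: relatively_shifting_prime3_def)
  have nonadj: "no_adjacent_zeros a b" "no_adjacent_zeros a c" "no_adjacent_zeros b c"
    unfolding no_adjacent_zeros_def
    using relatively_shifting_prime_no_adjacent_zeros[OF entire(1) nonzero(1) entire(2) nonzero(2) chain(1,2) prime(1)]
      relatively_shifting_prime_no_adjacent_zeros[OF entire(1) nonzero(1) entire(3) nonzero(3) chain(1,3) prime(2)]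
      relatively_shifting_prime_no_adjacent_zeros[OF entire(2) nonzero(2) entire(3) nonzero(3) chain(2,3) prime(3)]
    by blast+
  have bound: "\<exists>E K. finite_log_measure E \<and> (\<forall>r. r \<ge> 1 \<and> r \<notin> E \<longrightarrow>
      T_tilde [a, b, c] r \<le> Nbar_delta (\<lambda>z. a z * b z * c z) r + (t - 1) * ln r + K)"
    if st: "\<delta> < s" "s < t" "t < 1" for s t
  proof -
    have "0 < s" using st(1) \<delta>(2) by simp
    show ?thesis
    proof (cases "(\<lambda>z. a z * b (z + 1) - a (z + 1) * b z) = (\<lambda>_. 0)")
      case True
      then have "a z * b (z + 1) = a (z + 1) * b z" for z by (simp add: fun_eq_iff)
      then obtain E K where "finite_log_measure E" "\<And>r. r \<ge> 1 \<Longrightarrow> r \<notin> E \<Longrightarrow>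
          T_tilde [a, b, c] r \<le> Nbar_delta (\<lambda>z. a z * b z * c z) r + (t - 1) * ln r + K"
        using T_tilde_bound_casoratian_zero[OF entire nonzero nonadj growth[OF st(1)] \<open>0 < s\<close>
            st(2,3) sum assms(12)] by blast
      then show ?thesis by blast
    next
      case False
      obtain E K where "finite_log_measure E" "\<And>r. r \<ge> 1 \<Longrightarrow> r \<notin> E \<Longrightarrow>
          T_tilde [a, b, c] r \<le> Nbar_delta (\<lambda>z. a z * b z * c z) r + (t - 1) * ln r + K"
        using T_tilde_bound_casoratian[OF entire nonzero nonadj growth[OF st(1)] \<open>0 < s\<close>
            st(2,3) sum refl False] by blast
      then show ?thesis by blast
    qed
  qed
  show ?thesis
  proof (intro exI[of _ "1 :: real"] conjI allI impI)
    fix \<epsilon> :: real assume "\<epsilon> > 0"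
    \<comment> \<open>Capping \<open>\<epsilon>\<close> keeps the exponents below 1. The bound is
      applied with \<open>t = \<delta> + \<eta> / 2\<close>, so that
      \<open>\<eta> / 2 * ln r\<close> is left to absorb \<open>K\<close>.\<close>
    define \<eta> where "\<eta> = min \<epsilon> ((1 - \<delta>) / 2)"
    have \<eta>: "\<eta> > 0" "\<eta> \<le> \<epsilon>" "\<delta> + \<eta> < 1" using \<open>\<epsilon> > 0\<close> \<delta> by (auto simp: \<eta>_def min_def field_simps)
    obtain E K where E: "finite_log_measure E" and
      T: "\<And>r. r \<ge> 1 \<Longrightarrow> r \<notin> E \<Longrightarrow> T_tilde [a, b, c] r
        \<le> Nbar_delta (\<lambda>z. a z * b z * c z) r + (\<delta> + \<eta> / 2 - 1) * ln r + K"
      using bound[of "\<delta> + \<eta> / 4" "\<delta> + \<eta> / 2"] \<eta> by auto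
    \<comment> \<open>The radius at which \<open>\<eta> / 2 * ln r\<close> reaches \<open>K\<close>.
      It depends on \<open>\<epsilon>\<close>, so the radii up to it join the exceptional set
      instead of entering \<open>R\<close>.\<close>
    define r1 where "r1 = exp (2 * K / \<eta>)"
    show "\<exists>E. finite_log_measure E \<and>
           (\<forall>r. r > 1 \<and> r \<notin> E \<longrightarrow>
              T_tilde [a, b, c] r
                \<le> Nbar_delta (\<lambda>z. a z * b z * c z) r - (1 - \<delta> - \<epsilon>) * ln r \<and>
              Nbar_delta (\<lambda>z. a z * b z * c z) r - (1 - \<delta> - \<epsilon>) * ln r
                = Nbar_delta a r + Nbar_delta b r + Nbar_delta c r - (1 - \<delta> - \<epsilon>) * ln r)"
    proof (intro exI[of _ "E \<union> {1..r1}"] conjI allI impI)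
      show "finite_log_measure (E \<union> {1..r1})"
        by (intro finite_log_measure_Un E finite_log_measure_interval)
      fix r assume r: "r > 1 \<and> r \<notin> E \<union> {1..r1}"
      show "Nbar_delta (\<lambda>z. a z * b z * c z) r - (1 - \<delta> - \<epsilon>) * ln r
          = Nbar_delta a r + Nbar_delta b r + Nbar_delta c r - (1 - \<delta> - \<epsilon>) * ln r"
        using Nbar_delta_triple[OF entire nonzero nonadj, of r] r by simp
      have "ln r1 \<le> ln r" using r by (subst ln_le_cancel_iff) (auto simp: r1_def)
      then have "K \<le> \<eta> / 2 * ln r" using \<eta>(1) by (simp add: r1_def field_simps)
      moreover have "(\<delta> + \<eta> - 1) * ln r \<le> - (1 - \<delta> - \<epsilon>) * ln r"
        using r \<eta>(2) by (intro mult_right_mono) auto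
      moreover have "(\<delta> + \<eta> / 2 - 1) * ln r + \<eta> / 2 * ln r = (\<delta> + \<eta> - 1) * ln r"
        by (simp add: algebra_simps)
      moreover have "T_tilde [a, b, c] r
          \<le> Nbar_delta (\<lambda>z. a z * b z * c z) r + (\<delta> + \<eta> / 2 - 1) * ln r + K"
        using r by (intro T) auto
      ultimately show "T_tilde [a, b, c] r
          \<le> Nbar_delta (\<lambda>z. a z * b z * c z) r - (1 - \<delta> - \<epsilon>) * ln r"
        by linarith
    qed
  qed simp
qed

end
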